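(* Let $g$ be a probability density on $\mathbb{R}$ which is of class $C^n(\mathbb{R})$ for some integer $n\geq 4$ and satisfies $$\|g\|_{\mathcal{H}^n}<+\infty,\qquad \widehat{g}\in L^1(\mathbb{R}^+)\qquad\text{and}\qquad \int_{\mathbb{R}^+}t^n|\widehat{g}(t)|\,dt<+\infty.$$ Then, for any initial probability density $\frac{1}{2\pi}+\mathrm{r}(0)$ with $\mathrm{r}(0)$ of class $C^n(\mathbb{T}^1\times\mathbb{R})$ and $\|\mathrm{r}(0)\cdot g\|_{\mathcal{H}^n}<+\infty$, there exists $K_r>0$ such that for every $K\in[0,K_r)$, the order parameter $\mathrm{R}(t)$ associated with the solution of the Kuramoto equation (with density $g$ and coupling strength $K$) starting from $\frac1{2\pi}+\mathrm{r}(0)$ satisfies $$\mathrm{R}(t)=O(t^{-n})\qquad\text{as } t\to+\infty.$$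
   Context: Notation: $\mathbb{T}^1=\mathbb{R}/2\pi\mathbb{Z}$, $\mathbb{R}^+=[0,+\infty)$, $\langle\omega\rangle=\sqrt{1+\omega^2}$. The Fourier transform of $u\in L^1(\mathbb{R})$ is $\widehat{u}(\tau)=\int_{\mathbb{R}}u(\omega)e^{-i\tau\omega}d\omega$. Norms: for $u$ of class $C^n$ on $\mathbb{R}$, $\|u\|_{\mathcal{H}^n}^2=\sum_{k=0}^n\|\langle\omega\rangle u^{(k)}\|_{L^2(\mathbb{R})}^2$. For $u=u(\theta,\omega)$ of class $C^n$ on the cylinder $\mathbb{T}^1\times\mathbb{R}$, $\|u\|_{\mathcal{H}^n}^2=\sum_{k_\theta,k_\omega\geq0,\ k_\theta+k_\omega\leq n}\|\langle\omega\rangle\partial_\theta^{k_\theta}\partial_\omega^{k_\omega}u\|_{L^2(\mathbb{T}^1\times\mathbb{R})}^2$. Here $(\mathrm{r}\cdot g)(\theta,\omega)=\mathrm{r}(\theta,\omega)g(\omega)$. Kuramoto equation (continuum limit), with frequency density $g$ and coupling strength $K$: for densities $\rho(t,\theta,\omega)\geq0$ with $\int_{\mathbb{T}^1}\rho(t,\theta,\omega)d\theta=1$ for all $\omega\in\mathbb{R}$, $$\partial_t\rho+\omega\,\partial_\theta\rho+\partial_\theta\big(\rho\,V(\theta,\rho)\big)=0,\qquad V(\theta,\rho)=K\int_{\mathbb{T}^1\times\mathbb{R}}\sin(\vartheta-\theta)\rho(\vartheta,\omega)g(\omega)\,d\vartheta d\omega .$$ For every initial density of class $C^n$ there is a unique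 global solution on $\mathbb{R}^+$, which is of class $C^n$ and remains a normalised density. An "initial probability density $\frac1{2\pi}+\mathrm{r}(0)$" means $\frac1{2\pi}+\mathrm{r}(0,\theta,\omega)\geq0$ and $\int_{\mathbb{T}^1}\mathrm{r}(0,\theta,\omega)d\theta=0$ for all $\omega$. Writing the solution as $\rho(t)=\frac1{2\pi}+\mathrm{r}(t)$, the order parameter is $$\mathrm{R}(t)=\int_{\mathbb{T}^1\times\mathbb{R}}\mathrm{r}(t,\theta,\omega)g(\omega)e^{-i\theta}d\theta d\omega .$$ *)

theory Defs
  imports "HOL-Analysis.Analysis" "HOL-Library.Landau_Symbols"
begin

text \<open>
  A function on the cylinder (circle of length \<open>2\<pi>\<close> times the line) is a function of
  \<open>\<theta>\<close> and \<open>\<omega>\<close> that is \<open>2\<pi>\<close>-periodic in \<open>\<theta>\<close>; integrals over the cylinder are Lebesgue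
  integrals over one period.
\<close>

definition cylinder :: "(real \<times> real) set" where
  "cylinder = {0..2 * pi} \<times> UNIV"

definition bracket :: "real \<Rightarrow> real" where
  "bracket \<omega> = sqrt (1 + \<omega>\<^sup>2)"

definition fourier :: "(real \<Rightarrow> real) \<Rightarrow> real \<Rightarrow> complex" where
  "fourier u \<tau> = (LINT \<omega>|lborel. complex_of_real (u \<omega>) * exp (- (\<i> * complex_of_real (\<tau> * \<omega>))))"

definition probability_density :: "(real \<Rightarrow> real) \<Rightarrow> bool" where
  "probability_density g \<longleftrightarrow>
     (\<forall>\<omega>. 0 \<le> g \<omega>) \<and> integrable lborel g \<and> (LINT \<omega>|lborel. g \<omega>) = 1"


subsection \<open>Functions of class \<open>C\<^sup>n\<close>\<close>

definition class_C_line :: "nat \<Rightarrow> (real \<Rightarrow> real) \<Rightarrow> bool" where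
  "class_C_line n u \<longleftrightarrow>
     (\<forall>k<n. \<forall>\<omega>. (deriv ^^ k) u differentiable (at \<omega>)) \<and>
     (\<forall>k\<le>n. continuous_on UNIV ((deriv ^^ k) u))"

definition d_theta :: "(real \<Rightarrow> real \<Rightarrow> real) \<Rightarrow> real \<Rightarrow> real \<Rightarrow> real" where
  "d_theta u = (\<lambda>\<theta> \<omega>. deriv (\<lambda>x. u x \<omega>) \<theta>)"

definition d_omega :: "(real \<Rightarrow> real \<Rightarrow> real) \<Rightarrow> real \<Rightarrow> real \<Rightarrow> real" where
  "d_omega u = (\<lambda>\<theta> \<omega>. deriv (\<lambda>y. u \<theta> y) \<omega>)"

text \<open>All iterated partial derivatives of order at most \<open>n\<close>, in any order of
  differentiation, exist and are continuous.\<close>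

primrec class_C_plane :: "nat \<Rightarrow> (real \<Rightarrow> real \<Rightarrow> real) \<Rightarrow> bool" where
  "class_C_plane 0 u \<longleftrightarrow> continuous_on UNIV (\<lambda>(\<theta>, \<omega>). u \<theta> \<omega>)"
| "class_C_plane (Suc n) u \<longleftrightarrow>
     continuous_on UNIV (\<lambda>(\<theta>, \<omega>). u \<theta> \<omega>) \<and>
     (\<forall>\<theta> \<omega>. (\<lambda>x. u x \<omega>) differentiable (at \<theta>)) \<and>
     (\<forall>\<theta> \<omega>. (\<lambda>y. u \<theta> y) differentiable (at \<omega>)) \<and>
     class_C_plane n (d_theta u) \<and> class_C_plane n (d_omega u)"

definition class_C_cylinder :: "nat \<Rightarrow> (real \<Rightarrow> real \<Rightarrow> real) \<Rightarrow> bool" where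
  "class_C_cylinder n u \<longleftrightarrow> (\<forall>\<theta> \<omega>. u (\<theta> + 2 * pi) \<omega> = u \<theta> \<omega>) \<and> class_C_plane n u"


subsection \<open>The weighted Sobolev norms\<close>

text \<open>These are the \<^emph>\<open>squares\<close> of the norms, with value \<open>\<infinity>\<close> allowed; they are only meaningful
  for functions of class \<open>C\<^sup>n\<close>.\<close>

definition H_norm_sq_line :: "nat \<Rightarrow> (real \<Rightarrow> real) \<Rightarrow> ennreal" where
  "H_norm_sq_line n u =
     (\<Sum>k\<le>n. \<integral>\<^sup>+ \<omega>. ennreal ((bracket \<omega> * (deriv ^^ k) u \<omega>)\<^sup>2) \<partial>lborel)"

definition H_norm_sq_cylinder :: "nat \<Rightarrow> (real \<Rightarrow> real \<Rightarrow> real) \<Rightarrow> ennreal" where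
  "H_norm_sq_cylinder n u =
     (\<Sum>(k, l) \<in> {(k, l). k + l \<le> n}.
        \<integral>\<^sup>+ p \<in> cylinder.
          ennreal ((bracket (snd p) * (d_theta ^^ k) ((d_omega ^^ l) u) (fst p) (snd p))\<^sup>2) \<partial>lborel)"


subsection \<open>The Kuramoto equation\<close>

definition kuramoto_V :: "(real \<Rightarrow> real) \<Rightarrow> real \<Rightarrow> (real \<Rightarrow> real \<Rightarrow> real) \<Rightarrow> real \<Rightarrow> real" where
  "kuramoto_V g K u \<theta> =
     K * (LINT p:cylinder|lborel. sin (fst p - \<theta>) * u (fst p) (snd p) * g (snd p))"

definition normalised_density :: "(real \<Rightarrow> real \<Rightarrow> real) \<Rightarrow> bool" where
  "normalised_density u \<longleftrightarrow>
     (\<forall>\<theta> \<omega>. 0 \<le> u \<theta> \<omega>) \<and> (\<forall>\<omega>. (LINT \<theta>:{0..2 * pi}|lborel. u \<theta> \<omega>) = 1)"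

text \<open>
  Global classical solution of class \<open>C\<^sup>n\<close>: at each time \<open>t \<ge> 0\<close> a normalised density of class
  \<open>C\<^sup>n\<close> on the cylinder, whose derivatives in \<open>(\<theta>, \<omega>)\<close> up to order \<open>n\<close> depend continuously on
  \<open>(t, \<theta>, \<omega>)\<close>, and which satisfies the equation pointwise (with the one-sided time derivative
  at \<open>t = 0\<close>). Class \<open>C\<^sup>n\<close> concerns \<open>(\<theta>, \<omega>)\<close> only: \<open>\<omega> g(\<omega>)\<close> is not assumed integrable, so that the
  velocity field, and hence the solution, need not have higher time derivatives.
  Values of \<open>\<rho>\<close> at negative times are irrelevant.
\<close>

definition kuramoto_solution ::
  "nat \<Rightarrow> (real \<Rightarrow> real) \<Rightarrow> real \<Rightarrow> (real \<Rightarrow> real \<Rightarrow> real \<Rightarrow> real) \<Rightarrow> bool" where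
  "kuramoto_solution n g K \<rho> \<longleftrightarrow>
     (\<forall>t\<ge>0. class_C_cylinder n (\<rho> t) \<and> normalised_density (\<rho> t)) \<and>
     (\<forall>k l. k + l \<le> n \<longrightarrow>
        continuous_on ({0..} \<times> UNIV) (\<lambda>(t, \<theta>, \<omega>). (d_theta ^^ k) ((d_omega ^^ l) (\<rho> t)) \<theta> \<omega>)) \<and>
     (\<forall>t\<ge>0. \<forall>\<theta> \<omega>. \<exists>D.
        ((\<lambda>s. \<rho> s \<theta> \<omega>) has_real_derivative D) (at t within {0..}) \<and>
        D + \<omega> * deriv (\<lambda>\<theta>'. \<rho> t \<theta>' \<omega>) \<theta>
          + deriv (\<lambda>\<theta>'. \<rho> t \<theta>' \<omega> * kuramoto_V g K (\<rho> t) \<theta>') \<theta> = 0)"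

definition order_parameter :: "(real \<Rightarrow> real) \<Rightarrow> (real \<Rightarrow> real \<Rightarrow> real) \<Rightarrow> complex" where
  "order_parameter g r =
     (LINT p:cylinder|lborel.
        complex_of_real (r (fst p) (snd p) * g (snd p)) * exp (- (\<i> * complex_of_real (fst p))))"

end

theory Submission
  imports Defs "HOL-Probability.Sinc_Integral"
begin

text \<open>
  Let \<open>f\<^sub>k(t, \<tau>)\<close> be the Fourier transform in both variables of the solution times \<open>g\<close>, seen in the
  frame moving with free transport: \<open>f\<^sub>k(t, \<tau>) = \<integral>\<integral> \<rho> g e\<^sup>-\<^sup>i\<^sup>k\<^sup>\<theta> e\<^sup>i\<^sup>(\<^sup>k\<^sup>t\<^sup>-\<^sup>\<tau>\<^sup>)\<^sup>\<omega>\<close>. Then \<open>R(t) = f\<^sub>1(t, t)\<close>,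
  \<open>f\<^sub>0\<close> does not depend on \<open>t\<close>, and the equation becomes the hierarchy
  \<open>\<partial>\<^sub>t f\<^sub>k(t, \<tau>) = - (k K / 2) (cnj (R(t)) f\<^sub>k\<^sub>+\<^sub>1(t, \<tau> + t) - R(t) f\<^sub>k\<^sub>-\<^sub>1(t, \<tau> - t))\<close> for \<open>k > 0\<close>.
  At \<open>t = 0\<close> all \<open>f\<^sub>k\<close> are \<open>O((1 + \<bar>\<tau>\<bar>)\<^sup>-\<^sup>n)\<close> uniformly in \<open>k\<close>, by \<open>n\<close> integrations by parts in \<open>\<omega>\<close>.

  Suppose that \<open>\<bar>R(s)\<bar> \<le> N (1 + s)\<^sup>-\<^sup>n\<close> up to time \<open>t\<close>. The factor \<open>k\<close> is the loss of one derivative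
  in \<open>\<theta>\<close>, but the effective time \<open>K \<integral> \<bar>R\<bar>\<close> is small, so that a Cauchy-Kovalevskaya argument applies
  and gives \<open>\<bar>f\<^sub>k(s, \<tau>)\<bar> \<le> 4\<^sup>k (C + K N O(s)) (1 + \<bar>\<tau>\<bar>)\<^sup>-\<^sup>n\<close>. In the equation for \<open>R(t) = f\<^sub>1(t, t)\<close> only
  \<open>f\<^sub>0(t - s)\<close> and \<open>f\<^sub>2(s, t + s)\<close> occur, and the growth in \<open>s\<close> is absorbed by the decay of \<open>R(s)\<close>; this
  improves the constant \<open>N\<close> when \<open>K\<close> is small, and a continuity argument concludes.
\<close>

subsection \<open>A hierarchy of integral equations\<close>

text \<open>In the hierarchy the argument \<tau> moves by \<open>s\<close>, and this is the price of
  carrying the weight along. The price is a summand \<open>s ^ n\<close> and not a factor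
  \<open>(1 + s) ^ n\<close>: a factor would use up all the decay of \<open>R s\<close>, whereas
  here the weighted term keeps \<open>norm (R s)\<close> as an integrable coefficient and only the
  bounded quantity \<open>norm (R s) * s ^ n\<close> is added. The truncation at \<open>M\<close>
  makes the weighted modes bounded a priori.\<close>

lemma weight_shift:
  fixes x y s M :: real
  assumes "0 \<le> s" "\<bar>x - y\<bar> \<le> s" "0 \<le> M"
  shows "min ((1 + \<bar>x\<bar>) ^ n) M \<le> 2 ^ n * (min ((1 + \<bar>y\<bar>) ^ n) M + s ^ n)"
proof -
  have 1: "(1 + \<bar>x\<bar>) ^ n \<le> 2 ^ n * ((1 + \<bar>y\<bar>) ^ n + s ^ n)"
  proof -
    have "1 + \<bar>x\<bar> \<le> (1 + \<bar>y\<bar>) + s" using assms by linarith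
    also have "\<dots> \<le> 2 * max (1 + \<bar>y\<bar>) s" by (simp add: max_def)
    finally have "(1 + \<bar>x\<bar>) ^ n \<le> (2 * max (1 + \<bar>y\<bar>) s) ^ n" by (intro power_mono) auto
    also have "\<dots> = 2 ^ n * max (1 + \<bar>y\<bar>) s ^ n" by (simp add: power_mult_distrib)
    also have "max (1 + \<bar>y\<bar>) s ^ n \<le> (1 + \<bar>y\<bar>) ^ n + s ^ n"
      using assms by (auto simp: max_def)
    finally show ?thesis by simp
  qed
  have 2: "M \<le> 2 ^ n * (M + s ^ n)"
  proof -
    have "1 * M \<le> 2 ^ n * (M + s ^ n)"
      using assms by (intro mult_mono) auto
    then show ?thesis by simp
  qed
  show ?thesis
    using 1 2 by (auto simp: min_def)
qed

text \<open>
  The proof shows the bound \<open>(C + q s / 2 + M / 2\<^sup>J) L(s)\<^sup>k\<close> by induction on \<open>J\<close>. This is a supersolution of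
  the hierarchy because \<open>L' = L\<^sup>2 q / (1 + s)\<^sup>2\<close>, so that differentiating \<open>L\<^sup>k\<close> produces both the factor \<open>k\<close> and
  the index \<open>k + 1\<close>. The function \<open>L\<close> is chosen to grow twice as fast as necessary: each use of
  the integral equation then halves the contribution of the only bound known beforehand, which is
  \<open>\<bar>f\<^sub>k\<bar> \<le> 1\<close>, that is \<open>M\<close> for the weight truncated at \<open>M\<close>.
\<close>

lemma hierarchy_bound:
  fixes f :: "nat \<Rightarrow> real \<Rightarrow> real \<Rightarrow> complex" and R :: "real \<Rightarrow> complex" and K N C T q :: real
  assumes n: "2 \<le> n" and K: "0 \<le> K" and C: "0 \<le> C" and N: "0 \<le> N"
    and q_def: "q = 2 ^ (n + 1) * K * N" and q: "q \<le> 1 / 4"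
    and cont: "\<And>k. continuous_on ({0..T} \<times> UNIV) (\<lambda>(s, \<tau>). f k s \<tau>)"
    and contR: "continuous_on {0..T} R"
    and le1: "\<And>k t \<tau>. t \<in> {0..T} \<Longrightarrow> norm (f k t \<tau>) \<le> 1"
    and zero: "\<And>t \<tau>. t \<in> {0..T} \<Longrightarrow> f 0 t \<tau> = f 0 0 \<tau>"
    and duhamel: "\<And>k t \<tau>. 0 < k \<Longrightarrow> t \<in> {0..T} \<Longrightarrow>
       f k t \<tau> = f k 0 \<tau> - complex_of_real (k * K / 2) *
         integral {0..t} (\<lambda>s. cnj (R s) * f (k + 1) s (\<tau> + s) - R s * f (k - 1) s (\<tau> - s))"
    and init: "\<And>k \<tau>. (1 + \<bar>\<tau>\<bar>) ^ n * norm (f k 0 \<tau>) \<le> C"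
    and R: "\<And>s. s \<in> {0..T} \<Longrightarrow> norm (R s) * (1 + s) ^ n \<le> N"
    and t: "t \<in> {0..T}"
  shows "(1 + \<bar>\<tau>\<bar>) ^ n * norm (f k t \<tau>) \<le> (C + q * t / 2) * 4 ^ k"
proof -
  have q0: "0 \<le> q" using K N by (simp add: q_def)
  \<comment> \<open>The start value 2 gives \<open>k \<le> L s ^ k\<close>, which absorbs the factor
    \<open>k\<close> of the inhomogeneous term; \<open>q \<le> 1 / 4\<close> keeps the denominator
    above 1/4, so that \<open>L\<close> stays below 4. The integral of
    \<open>1 / (1 + s)\<^sup>2\<close> is \<open>s / (1 + s)\<close>.\<close>
  define L where "L s = inverse (1 / 2 - q * (s / (1 + s)))" for s
  have den: "1 / 4 \<le> 1 / 2 - q * (s / (1 + s))" "1 / 2 - q * (s / (1 + s)) \<le> 1 / 2" if "0 \<le> s" for s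
  proof -
    have "0 \<le> s / (1 + s)" "s / (1 + s) \<le> 1" using that by (auto simp: field_simps)
    then have "q * (s / (1 + s)) \<le> 1 / 4 * 1" "0 \<le> q * (s / (1 + s))"
      using q q0 by (intro mult_mono mult_nonneg_nonneg; simp)+
    then show "1 / 4 \<le> 1 / 2 - q * (s / (1 + s))" "1 / 2 - q * (s / (1 + s)) \<le> 1 / 2"
      by linarith+
  qed
  have L2: "2 \<le> L s" and L4: "L s \<le> 4" if "0 \<le> s" for s
  proof -
    have pos: "0 < 1 / 2 - q * (s / (1 + s))" using den(1)[OF that] by linarith
    show "2 \<le> L s" "L s \<le> 4"
      using le_imp_inverse_le[OF den(1)[OF that]] le_imp_inverse_le[OF den(2)[OF that] pos]
      by (auto simp: L_def)
  qed
  have dL: "(L has_real_derivative (L s)\<^sup>2 * (q / (1 + s)\<^sup>2)) (at s within X)" if "0 \<le> s" for s X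
  proof -
    have nz: "1 / 2 - q * (s / (1 + s)) \<noteq> 0" using den(1)[OF that] by linarith
    have "1 + s \<noteq> 0" using that by simp
    show ?thesis
      unfolding L_def
      apply (rule derivative_eq_intros refl nz \<open>1 + s \<noteq> 0\<close>)+
      using \<open>1 + s \<noteq> 0\<close> by (simp add: power2_eq_square)
  qed
  have main: "min ((1 + \<bar>\<tau>\<bar>) ^ n) M * norm (f k t \<tau>) \<le> (C + q * t / 2 + M / 2 ^ J) * L t ^ k"
    if M: "0 \<le> M" and "t \<in> {0..T}" for M J k t \<tau>
    using that(2)
  proof (induction J arbitrary: k t \<tau>)
    case 0
    have "min ((1 + \<bar>\<tau>\<bar>) ^ n) M * norm (f k t \<tau>) \<le> M * 1"
      using le1[OF 0] M by (intro mult_mono) auto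
    also have "\<dots> \<le> (C + q * t / 2 + M) * L t ^ k"
      using 0 q0 C M L2[of t] by (intro mult_mono) (auto intro!: one_le_power)
    finally show ?case by simp
  next
    case (Suc J)
    define E where "E J k s = (C + q * s / 2 + M / 2 ^ J) * L s ^ k" for J :: nat and k :: nat and s
    define w where "w x = min ((1 + \<bar>x\<bar>) ^ n) M" for x
    have IH: "w x * norm (f k s x) \<le> E J k s" if "s \<in> {0..T}" for s k x
      using Suc.IH[OF that] by (simp add: E_def w_def)
    have w0: "0 \<le> w x" for x using M by (simp add: w_def)
    \<comment> \<open>Since \<open>L\<close> is at least 1, the bound for the index
      \<open>k + 1\<close> also serves for \<open>k - 1\<close>, and both neighbours are treated
      alike.\<close>
    have E_mono: "E J k s \<le> E J l s" if "k \<le> l" "0 \<le> s" for k l s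
      using that L2[of s] C q0 M unfolding E_def
      by (intro mult_left_mono power_increasing add_nonneg_nonneg) auto
    have t0: "0 \<le> t" and tT: "t \<le> T" using Suc.prems by auto
    have init_w: "w \<tau> * norm (f k 0 \<tau>) \<le> C" for k
      using init[of \<tau> k] mult_right_mono[of "w \<tau>" "(1 + \<bar>\<tau>\<bar>) ^ n" "norm (f k 0 \<tau>)"]
      by (simp add: w_def)
    show ?case
    proof (cases "k = 0")
      case True
      have "0 \<le> q * t / 2" "0 \<le> M / 2 ^ Suc J" using q0 t0 M by auto
      then have "C \<le> C + q * t / 2 + M / 2 ^ Suc J" by linarith
      then show ?thesis
        using True init_w[of 0] zero[OF Suc.prems, of \<tau>] by (simp add: w_def)
    next
      case False
      \<comment> \<open>\<open>D\<close> is the time derivative of the bound to be proved, so it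
        suffices to dominate the weighted integrand of the integral equation by \<open>D\<close> at
        each time.\<close>
      define D where "D s = q / 2 * L s ^ k +
         (C + q * s / 2 + M / 2 ^ Suc J) * (of_nat k * L s ^ (k - 1) * ((L s)\<^sup>2 * (q / (1 + s)\<^sup>2)))" for s
      have DE: "(E (Suc J) k has_real_derivative D s) (at s within X)" if "0 \<le> s" for s X
        unfolding E_def D_def
        by (rule derivative_eq_intros dL[OF that] refl | simp)+
      have D_int: "(D has_integral (E (Suc J) k t - E (Suc J) k 0)) {0..t}"
        using DE t0
        by (intro fundamental_theorem_of_calculus)
           (auto simp: has_real_derivative_iff_has_vector_derivative[symmetric])
      define h where "h s = cnj (R s) * f (k + 1) s (\<tau> + s) - R s * f (k - 1) s (\<tau> - s)" for s
      have cont_f: "continuous_on {0..t} (\<lambda>s. f k s (\<sigma> s))"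
        if "continuous_on {0..t} \<sigma>" for k and \<sigma> :: "real \<Rightarrow> real"
      proof -
        have "continuous_on {0..t} (\<lambda>s. case (s, \<sigma> s) of (s, \<tau>) \<Rightarrow> f k s \<tau>)"
          by (rule continuous_on_compose2[OF cont[of k]])
             (use tT in \<open>auto intro!: continuous_intros that\<close>)
        then show ?thesis by simp
      qed
      have cont_h: "continuous_on {0..t} h"
        unfolding h_def using tT
        by (intro continuous_intros cont_f continuous_on_subset[OF contR]) auto
      have bound: "norm (complex_of_real (w \<tau> * (k * K / 2)) * h s) \<le> D s" if s: "s \<in> {0..t}" for s
      proof -
        have s0: "0 \<le> s" and sT: "s \<in> {0..T}" using s tT by auto
        \<comment> \<open>The induction hypothesis is used in the term that keeps the weight; in the
          term with \<open>s ^ n\<close> the bound 1 on the mode suffices.\<close>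
        have shift: "w \<tau> * norm (f j s \<sigma>) \<le> 2 ^ n * (E J (k + 1) s + s ^ n)"
          if "\<bar>\<tau> - \<sigma>\<bar> \<le> s" "j \<le> k + 1" for j \<sigma>
        proof -
          have "w \<tau> * norm (f j s \<sigma>) \<le> (2 ^ n * (w \<sigma> + s ^ n)) * norm (f j s \<sigma>)"
            unfolding w_def using weight_shift[OF s0 that(1) M] by (intro mult_right_mono) auto
          also have "\<dots> = 2 ^ n * (w \<sigma> * norm (f j s \<sigma>) + s ^ n * norm (f j s \<sigma>))"
            by (simp add: algebra_simps)
          also have "\<dots> \<le> 2 ^ n * (E J (k + 1) s + s ^ n * 1)"
            using IH[OF sT, of \<sigma> j] E_mono[OF that(2) s0] le1[OF sT, of j \<sigma>] s0
            by (intro mult_left_mono add_mono) auto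
          finally show ?thesis by simp
        qed
        \<comment> \<open>The decay of \<open>R\<close> is spent in two ways: its square part as the
          integrable coefficient of \<open>E\<close>, and its full order against
          \<open>s ^ n\<close>.\<close>
        have Rle: "norm (R s) \<le> N / (1 + s)\<^sup>2" and Rle': "norm (R s) * s ^ n \<le> N"
        proof -
          have "norm (R s) * (1 + s)\<^sup>2 \<le> norm (R s) * (1 + s) ^ n"
            using s0 n by (intro mult_left_mono power_increasing) auto
          also have "\<dots> \<le> N" by (rule R[OF sT])
          finally show "norm (R s) \<le> N / (1 + s)\<^sup>2" using s0 by (simp add: field_simps)
          have "norm (R s) * s ^ n \<le> norm (R s) * (1 + s) ^ n"
            using s0 by (intro mult_left_mono power_mono) auto
          also have "\<dots> \<le> N" by (rule R[OF sT])
          finally show "norm (R s) * s ^ n \<le> N" .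
        qed
        have E0: "0 \<le> E J (k + 1) s"
          unfolding E_def using L2[OF s0] C q0 s0 M by auto
        have "norm (complex_of_real (w \<tau> * (k * K / 2)) * h s) = (k * K / 2) * (w \<tau> * norm (h s))"
          using w0[of \<tau>] K by (simp add: norm_mult)
        also have "\<dots> \<le> (k * K / 2) * (w \<tau> * (norm (R s) * norm (f (k + 1) s (\<tau> + s)) +
                           norm (R s) * norm (f (k - 1) s (\<tau> - s))))"
          using w0 K unfolding h_def
          by (intro mult_left_mono) (auto intro!: norm_triangle_ineq4[THEN order_trans] simp: norm_mult)
        also have "\<dots> = (k * K / 2) * (norm (R s) * (w \<tau> * norm (f (k + 1) s (\<tau> + s)) +
                           w \<tau> * norm (f (k - 1) s (\<tau> - s))))"
          by (simp add: algebra_simps)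
        also have "\<dots> \<le> (k * K / 2) * (norm (R s) *
               (2 ^ n * (E J (k + 1) s + s ^ n) + 2 ^ n * (E J (k + 1) s + s ^ n)))"
          using K s0 by (intro mult_left_mono add_mono shift) auto
        also have "\<dots> = (k * K * 2 ^ n) * (norm (R s) * E J (k + 1) s + norm (R s) * s ^ n)"
          by (simp add: algebra_simps)
        also have "\<dots> \<le> (k * K * 2 ^ n) * (N / (1 + s)\<^sup>2 * E J (k + 1) s + N)"
          using K Rle Rle' E0 by (intro mult_left_mono add_mono mult_right_mono) auto
        also have "\<dots> = k * q / 2 / (1 + s)\<^sup>2 * E J (k + 1) s + q / 2 * k"
          by (simp add: q_def algebra_simps)
        also have "\<dots> \<le> D s"
        proof -
          have "real k \<le> 2 ^ k" by (simp add: less_imp_le)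
          also have "\<dots> \<le> L s ^ k" using L2[OF s0] by (intro power_mono) auto
          finally have a: "q / 2 * k \<le> q / 2 * L s ^ k" using q0 by (intro mult_left_mono) auto
          have e: "L s ^ (k + 1) = L s ^ (k - 1) * (L s)\<^sup>2"
            using False by (simp add: power_add[symmetric])
          \<comment> \<open>The factor 1/2 in front of \<open>q\<close> turns
            \<open>M / 2 ^ J\<close> into \<open>M / 2 ^ Suc J\<close>, while \<open>C\<close> and
            \<open>q * s / 2\<close> have half of their value to spare. The summand
            \<open>q / 2 * L s ^ k\<close> of \<open>D\<close> is left for the inhomogeneous
            term.\<close>
          have "k * q / 2 / (1 + s)\<^sup>2 * E J (k + 1) s
             = (C / 2 + q * s / 4 + M / 2 ^ Suc J) * (k * (q / (1 + s)\<^sup>2) * L s ^ (k + 1))"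
            unfolding E_def by (simp add: field_simps)
          also have "\<dots> \<le> (C + q * s / 2 + M / 2 ^ Suc J) * (k * (q / (1 + s)\<^sup>2) * L s ^ (k + 1))"
          proof (rule mult_right_mono)
            have "0 \<le> q * s" using q0 s0 by simp
            then show "C / 2 + q * s / 4 + M / 2 ^ Suc J \<le> C + q * s / 2 + M / 2 ^ Suc J"
              using C by simp
          qed (use q0 s0 L2[OF s0] in auto)
          also have "\<dots> = D s - q / 2 * L s ^ k"
            unfolding D_def e by (simp add: mult_ac)
          finally show ?thesis using a by linarith
        qed
        finally show ?thesis .
      qed
      have "norm (integral {0..t} (\<lambda>s. complex_of_real (w \<tau> * (k * K / 2)) * h s)) \<le> integral {0..t} D"
      proof (rule Henstock_Kurzweil_Integration.integral_norm_bound_integral)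
        show "D integrable_on {0..t}" using D_int by blast
      qed (use bound in \<open>auto intro!: integrable_continuous_real continuous_intros cont_h\<close>)
      also have "\<dots> = E (Suc J) k t - E (Suc J) k 0"
        using D_int by (rule integral_unique)
      finally have I: "w \<tau> * norm (complex_of_real (k * K / 2) * integral {0..t} h) \<le> E (Suc J) k t - E (Suc J) k 0"
        using w0[of \<tau>] K by (simp add: norm_mult mult_ac)
      have E0: "C \<le> E (Suc J) k 0"
      proof -
        have "C * 1 \<le> (C + M / 2 ^ Suc J) * L 0 ^ k"
          using C M L2[of 0] by (intro mult_mono) (auto intro!: one_le_power)
        then show ?thesis by (simp add: E_def)
      qed
      have "w \<tau> * norm (f k t \<tau>) \<le> w \<tau> * (norm (f k 0 \<tau>) + norm (complex_of_real (k * K / 2) * integral {0..t} h))"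
        using duhamel[OF _ Suc.prems, of k \<tau>] False w0
        by (intro mult_left_mono) (auto simp: h_def[abs_def] intro!: norm_triangle_ineq4[THEN order_trans])
      also have "\<dots> \<le> E (Suc J) k t"
        using I init_w[of k] E0 by (simp add: algebra_simps)
      finally show ?thesis by (simp add: E_def w_def)
    qed
  qed
  \<comment> \<open>At the given \<tau> the truncation at this level changes nothing; the level
    stays fixed while \<open>J\<close> tends to infinity.\<close>
  define W where "W = (1 + \<bar>\<tau>\<bar>) ^ n"
  have "(1 + \<bar>\<tau>\<bar>) ^ n * norm (f k t \<tau>) \<le> (C + q * t / 2 + W / 2 ^ J) * L t ^ k" for J
    using main[of W t \<tau> k J] t by (simp add: W_def)
  moreover have "(\<lambda>J. (C + q * t / 2 + W * (1 / 2) ^ J) * L t ^ k) \<longlonglongrightarrow> (C + q * t / 2 + W * 0) * L t ^ k"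
    by (intro tendsto_intros LIMSEQ_realpow_zero) auto
  ultimately have "(1 + \<bar>\<tau>\<bar>) ^ n * norm (f k t \<tau>) \<le> (C + q * t / 2) * L t ^ k"
    by (intro LIMSEQ_le_const[where X="\<lambda>J. (C + q * t / 2 + W * (1 / 2) ^ J) * L t ^ k"])
       (auto simp: power_one_over field_simps)
  also have "\<dots> \<le> (C + q * t / 2) * 4 ^ k"
    using t C q0 L2[of t] L4[of t] by (intro mult_left_mono power_mono) auto
  finally show ?thesis .
qed

subsection \<open>Decay of Fourier transforms\<close>

text \<open>\<open>F (x + 1) - F x\<close> is the integral of \<open>F'\<close> over an interval of
  length 1. Its integral over all \<open>x\<close> is that of \<open>F'\<close> by Fubini, and 0 by
  translation invariance. Limits of \<open>F\<close> at infinity never enter.\<close>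

lemma integral_derivative_eq_0:
  fixes F F' :: "real \<Rightarrow> complex"
  assumes deriv: "\<And>x. (F has_vector_derivative F' x) (at x)"
    and F: "integrable lborel F" and F': "integrable lborel F'"
    and cont: "continuous_on UNIV F'"
  shows "(LBINT x. F' x) = 0"
proof -
  have meas[measurable]: "F' \<in> borel_measurable borel"
    using cont by (rule borel_measurable_continuous_onI)
  have shift: "integrable lborel (\<lambda>x. H (x + s))" "(LBINT x. H (x + s)) = (LBINT x. H x)"
    if "integrable lborel H" for s and H :: "real \<Rightarrow> 'c :: euclidean_space"
    using that lborel_integrable_real_affine[of H 1 s] lborel_integral_real_affine[of 1 H s]
    by (simp_all add: add.commute)
  have int2: "integrable (lborel \<Otimes>\<^sub>M lborel) (\<lambda>(s, x). indicator {0..1} s *\<^sub>R F' (x + s))"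
  proof (rule lborel_pair.Fubini_integrable)
    have "integrable lborel (\<lambda>s::real. indicator {0..1} s *\<^sub>R (LBINT x. norm (F' x)) :: real)"
      by (intro integrable_scaleR_left integrable_real_indicator) auto
    moreover have "(\<lambda>s. LBINT x. norm (indicator {0..1} s *\<^sub>R F' (x + s))) =
        (\<lambda>s::real. indicator {0..1} s *\<^sub>R (LBINT x. norm (F' x)))"
      using shift(2)[OF integrable_norm[OF F']] by (auto simp: fun_eq_iff)
    ultimately show "integrable lborel
        (\<lambda>s. LBINT x. norm (case (s, x) of (s, x) \<Rightarrow> indicator {0..1} s *\<^sub>R F' (x + s)))"
      unfolding prod.case by (simp only:)
    show "AE s in lborel. integrable lborel
        (\<lambda>x. case (s, x) of (s, x) \<Rightarrow> indicator {0..1} s *\<^sub>R F' (x + s))"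
      using shift(1)[OF F'] by simp
  qed measurable
  have inner: "(LBINT s. indicator {0..1} s *\<^sub>R F' (x + s)) = F (x + 1) - F x" for x
  proof -
    have "continuous_on {0..1} (\<lambda>s. F' (x + s))"
      by (intro continuous_on_compose2[OF cont] continuous_intros) auto
    moreover have "((\<lambda>s. F (x + s)) has_vector_derivative F' (x + s)) (at s within {0..1})" for s
    proof -
      have "((\<lambda>s. x + s) has_vector_derivative 1) (at s)"
        by (auto intro!: derivative_eq_intros)
      from vector_diff_chain_at[OF this deriv] show ?thesis
        by (simp add: o_def has_vector_derivative_at_within)
    qed
    ultimately show ?thesis
      using integral_FTC_Icc[of 0 1 "\<lambda>s. F (x + s)" "\<lambda>s. F' (x + s)"] by simp
  qed
  have "(LBINT x. LBINT s. indicator {0..1} s *\<^sub>R F' (x + s)) =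
        (LBINT s. LBINT x. indicator {0..1} s *\<^sub>R F' (x + s))"
    by (rule lborel_pair.Fubini_integral[OF int2])
  also have "\<dots> = (LBINT s::real. indicator {0..1} s *\<^sub>R (LBINT x. F' x))"
    using shift(2)[OF F'] by simp
  also have "\<dots> = (LBINT s. indicator {0..1::real} s) *\<^sub>R (LBINT x. F' x)"
    by (intro integral_scaleR_left integrable_real_indicator) auto
  also have "\<dots> = (LBINT x. F' x)" by simp
  finally have "(LBINT x. F' x) = (LBINT x. F (x + 1) - F x)" by (simp add: inner)
  also have "\<dots> = 0"
    using shift[OF F, of 1] F by (simp add: Bochner_Integration.integral_diff)
  finally show ?thesis .
qed

text \<open>Each step is an integration by parts without boundary terms: the derivative of
  \<open>G l x * cis (- (\<tau> * x))\<close> has integral 0. The derivatives form a family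
  \<open>G\<close> because they are used both for Fourier coefficients of \<omega>-derivatives and
  for the iterates of \<open>deriv\<close> on \<open>g\<close>.\<close>

lemma fourier_derivative:
  fixes G :: "nat \<Rightarrow> real \<Rightarrow> complex"
  assumes deriv: "\<And>l x. l < n \<Longrightarrow> (G l has_vector_derivative G (Suc l) x) (at x)"
    and int: "\<And>l. l \<le> n \<Longrightarrow> integrable lborel (G l)"
    and cont: "continuous_on UNIV (G n)"
  shows "(LBINT x. G n x * cis (- (\<tau> * x))) = (\<i> * of_real \<tau>) ^ n * (LBINT x. G 0 x * cis (- (\<tau> * x)))"
proof -
  have contG: "continuous_on UNIV (G l)" if "l \<le> n" for l
  proof (cases "l = n")
    case False
    then show ?thesis
      using deriv[of l] that
      by (auto intro!: continuous_at_imp_continuous_on has_vector_derivative_continuous)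
  qed (use cont in simp)
  have int_cis: "integrable lborel (\<lambda>x. G l x * cis (- (\<tau> * x)))" if "l \<le> n" for l
  proof (rule Bochner_Integration.integrable_bound[OF int[OF that]])
    show "(\<lambda>x. G l x * cis (- (\<tau> * x))) \<in> borel_measurable lborel"
      using contG[OF that]
      by (auto intro!: borel_measurable_continuous_onI continuous_intros)
  qed (simp add: norm_mult)
  have "(LBINT x. G l x * cis (- (\<tau> * x))) = (\<i> * of_real \<tau>) ^ l * (LBINT x. G 0 x * cis (- (\<tau> * x)))"
    if "l \<le> n" for l
    using that
  proof (induction l)
    case (Suc l)
    define F' where "F' x = G (Suc l) x * cis (- (\<tau> * x)) - (\<i> * of_real \<tau>) * (G l x * cis (- (\<tau> * x)))" for x
    have "(LBINT x. F' x) = 0"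
    proof (rule integral_derivative_eq_0)
      show "((\<lambda>x. G l x * cis (- (\<tau> * x))) has_vector_derivative F' x) (at x)" for x
      proof -
        have "((\<lambda>x. cis (- (\<tau> * x))) has_derivative (\<lambda>t. (- (\<tau> * t)) *\<^sub>R (\<i> * cis (- (\<tau> * x))))) (at x)"
          by (rule has_derivative_cis) (auto intro!: derivative_eq_intros)
        then have c: "((\<lambda>x. cis (- (\<tau> * x))) has_vector_derivative (- (\<i> * of_real \<tau>) * cis (- (\<tau> * x)))) (at x)"
          unfolding has_vector_derivative_def
          by (simp add: scaleR_conv_of_real mult_ac)
        show ?thesis
          using has_vector_derivative_mult[OF deriv[of l x] c] Suc.prems
          by (simp add: F'_def algebra_simps)
      qed
      show "integrable lborel F'"
        unfolding F'_def using Suc.prems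
        by (intro Bochner_Integration.integrable_diff integrable_mult_right int_cis) simp_all
      show "continuous_on UNIV F'"
        unfolding F'_def using Suc.prems by (intro continuous_intros contG) simp_all
      show "integrable lborel (\<lambda>x. G l x * cis (- (\<tau> * x)))"
        using Suc.prems by (intro int_cis) simp
    qed
    moreover have "(LBINT x. F' x) = (LBINT x. G (Suc l) x * cis (- (\<tau> * x))) -
        (\<i> * of_real \<tau>) * (LBINT x. G l x * cis (- (\<tau> * x)))"
    proof -
      have "integrable lborel (\<lambda>x. (\<i> * of_real \<tau>) * (G l x * cis (- (\<tau> * x))))"
        using Suc.prems by (intro integrable_mult_right int_cis) simp
      from Bochner_Integration.integral_diff[OF int_cis[OF Suc.prems] this]
      show ?thesis by (simp add: F'_def)
    qed
    ultimately show ?case using Suc by (simp del: of_real_power)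
  qed simp
  from this[of n] show ?thesis by blast
qed

text \<open>The weight is at most \<open>2 ^ n * (1 + \<bar>\<tau>\<bar> ^ n)\<close>, and the
  factor \<open>\<bar>\<tau>\<bar> ^ n\<close> is exchanged for \<open>n\<close> derivatives. Hence
  only the two extreme members of the family appear in the bound.\<close>

lemma fourier_decay:
  fixes G :: "nat \<Rightarrow> real \<Rightarrow> complex"
  assumes deriv: "\<And>l x. l < n \<Longrightarrow> (G l has_vector_derivative G (Suc l) x) (at x)"
    and int: "\<And>l. l \<le> n \<Longrightarrow> integrable lborel (G l)"
    and cont: "continuous_on UNIV (G n)"
  shows "(1 + \<bar>\<tau>\<bar>) ^ n * norm (LBINT x. G 0 x * cis (- (\<tau> * x)))
    \<le> 2 ^ n * ((LBINT x. norm (G 0 x)) + (LBINT x. norm (G n x)))"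
proof -
  define I where "I = norm (LBINT x. G 0 x * cis (- (\<tau> * x)))"
  have norm_le: "norm (LBINT x. G l x * cis (- (\<tau> * x))) \<le> (LBINT x. norm (G l x))" for l
    using integral_norm_bound[of lborel "\<lambda>x. G l x * cis (- (\<tau> * x))"] by (simp add: norm_mult)
  have "(1 + \<bar>\<tau>\<bar>) ^ n \<le> (2 * max 1 \<bar>\<tau>\<bar>) ^ n" by (intro power_mono) auto
  also have "\<dots> = 2 ^ n * max 1 \<bar>\<tau>\<bar> ^ n" by (simp add: power_mult_distrib)
  also have "\<dots> \<le> 2 ^ n * (1 + \<bar>\<tau>\<bar> ^ n)"
    by (intro mult_left_mono) (auto simp: max_def)
  finally have "(1 + \<bar>\<tau>\<bar>) ^ n * I \<le> 2 ^ n * (1 + \<bar>\<tau>\<bar> ^ n) * I"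
    by (intro mult_right_mono) (auto simp: I_def)
  also have "\<dots> = 2 ^ n * (I + \<bar>\<tau>\<bar> ^ n * I)" by (simp add: algebra_simps)
  also have "\<bar>\<tau>\<bar> ^ n * I = norm (LBINT x. G n x * cis (- (\<tau> * x)))"
    by (subst fourier_derivative[OF assms]) (auto simp: norm_mult norm_power I_def)
  also have "2 ^ n * (I + \<dots>) \<le> 2 ^ n * ((LBINT x. norm (G 0 x)) + (LBINT x. norm (G n x)))"
    using norm_le[of 0] norm_le[of n] by (intro mult_left_mono add_mono) (auto simp: I_def)
  finally show ?thesis by (simp add: I_def)
qed

subsection \<open>Functions of class \<open>C\<^sup>n\<close> and integrals on the cylinder\<close>

lemma class_C_plane_continuous: "class_C_plane n u \<Longrightarrow> continuous_on UNIV (\<lambda>(\<theta>, \<omega>). u \<theta> \<omega>)"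
  by (cases n) auto

lemma class_C_plane_mono: "class_C_plane n u \<Longrightarrow> m \<le> n \<Longrightarrow> class_C_plane m u"
proof (induction n arbitrary: m u)
  case (Suc n)
  then show ?case by (cases m) auto
qed simp

lemma class_C_plane_zero: "class_C_plane n (\<lambda>\<theta> \<omega>. 0)"
  by (induction n) (auto simp: d_theta_def d_omega_def)

lemma class_C_plane_add:
  "class_C_plane n u \<Longrightarrow> class_C_plane n v \<Longrightarrow> class_C_plane n (\<lambda>\<theta> \<omega>. u \<theta> \<omega> + v \<theta> \<omega>)"
proof (induction n arbitrary: u v)
  case 0
  then show ?case by (auto simp: case_prod_unfold intro!: continuous_intros)
next
  case (Suc n)
  have u: "(\<lambda>x. u x \<omega>) differentiable (at \<theta>)" "(\<lambda>y. u \<theta> y) differentiable (at \<omega>)"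
    and v: "(\<lambda>x. v x \<omega>) differentiable (at \<theta>)" "(\<lambda>y. v \<theta> y) differentiable (at \<omega>)" for \<theta> \<omega>
    using Suc.prems by auto
  have "d_theta (\<lambda>\<theta> \<omega>. u \<theta> \<omega> + v \<theta> \<omega>) = (\<lambda>\<theta> \<omega>. d_theta u \<theta> \<omega> + d_theta v \<theta> \<omega>)"
    "d_omega (\<lambda>\<theta> \<omega>. u \<theta> \<omega> + v \<theta> \<omega>) = (\<lambda>\<theta> \<omega>. d_omega u \<theta> \<omega> + d_omega v \<theta> \<omega>)"
    using u v by (auto simp: d_theta_def d_omega_def fun_eq_iff field_differentiable_def real_differentiable_def
      intro!: deriv_add)
  then show ?case
    using Suc u v by (auto simp: case_prod_unfold intro!: continuous_intros)
qed

text \<open>Needed for the product of \<open>r0\<close> and \<open>g\<close>, whose regularity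
  governs the initial moments. By the product rule each partial derivative is a sum of products of
  functions that are of class \<open>n\<close>, to which the induction applies.\<close>

lemma class_C_plane_mult:
  "class_C_plane n u \<Longrightarrow> class_C_plane n v \<Longrightarrow> class_C_plane n (\<lambda>\<theta> \<omega>. u \<theta> \<omega> * v \<theta> \<omega>)"
proof (induction n arbitrary: u v)
  case 0
  then show ?case by (auto simp: case_prod_unfold intro!: continuous_intros)
next
  case (Suc n)
  have u: "(\<lambda>x. u x \<omega>) differentiable (at \<theta>)" "(\<lambda>y. u \<theta> y) differentiable (at \<omega>)"
    and v: "(\<lambda>x. v x \<omega>) differentiable (at \<theta>)" "(\<lambda>y. v \<theta> y) differentiable (at \<omega>)" for \<theta> \<omega>
    using Suc.prems by auto
  have d: "d_theta (\<lambda>\<theta> \<omega>. u \<theta> \<omega> * v \<theta> \<omega>) = (\<lambda>\<theta> \<omega>. u \<theta> \<omega> * d_theta v \<theta> \<omega> + d_theta u \<theta> \<omega> * v \<theta> \<omega>)"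
    "d_omega (\<lambda>\<theta> \<omega>. u \<theta> \<omega> * v \<theta> \<omega>) = (\<lambda>\<theta> \<omega>. u \<theta> \<omega> * d_omega v \<theta> \<omega> + d_omega u \<theta> \<omega> * v \<theta> \<omega>)"
    using u v by (auto simp: d_theta_def d_omega_def fun_eq_iff field_differentiable_def real_differentiable_def
      intro!: deriv_mult)
  have "class_C_plane n u" "class_C_plane n v"
    using class_C_plane_mono[OF Suc.prems(1), of n] class_C_plane_mono[OF Suc.prems(2), of n] by simp_all
  then have "class_C_plane n (d_theta (\<lambda>\<theta> \<omega>. u \<theta> \<omega> * v \<theta> \<omega>))"
    "class_C_plane n (d_omega (\<lambda>\<theta> \<omega>. u \<theta> \<omega> * v \<theta> \<omega>))"
    unfolding d using Suc.prems by (simp_all add: class_C_plane_add Suc.IH)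
  then show ?case
    using Suc.prems u v by (auto simp: case_prod_unfold intro!: continuous_intros)
qed

lemma class_C_line_imp_plane: "class_C_line n g \<Longrightarrow> class_C_plane n (\<lambda>\<theta> \<omega>. g \<omega>)"
proof (induction n arbitrary: g)
  case 0
  then have "continuous_on UNIV g" by (auto simp: class_C_line_def)
  then show ?case
    using continuous_on_compose2[of UNIV g UNIV snd] by (auto simp: case_prod_unfold continuous_on_snd)
next
  case (Suc n)
  have step: "(deriv ^^ k) (deriv g) = (deriv ^^ Suc k) g" for k
    by (simp add: funpow_swap1)
  have "class_C_line n (deriv g)"
    using Suc.prems unfolding class_C_line_def step by auto
  moreover have "continuous_on UNIV g" "\<And>\<omega>. g differentiable (at \<omega>)"
    using Suc.prems unfolding class_C_line_def by (auto dest: spec[of _ 0])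
  moreover have "d_theta (\<lambda>\<theta> \<omega>. g \<omega>) = (\<lambda>\<theta> \<omega>. 0)" "d_omega (\<lambda>\<theta> \<omega>. g \<omega>) = (\<lambda>\<theta> \<omega>. deriv g \<omega>)"
    by (auto simp: d_theta_def d_omega_def)
  ultimately show ?case
    using Suc.IH[of "deriv g"] class_C_plane_zero continuous_on_compose2[of UNIV g UNIV snd]
    by (auto simp: case_prod_unfold continuous_on_snd)
qed

lemma class_C_plane_d_omega:
  "class_C_plane n u \<Longrightarrow> l \<le> n \<Longrightarrow> class_C_plane (n - l) ((d_omega ^^ l) u)"
proof (induction l)
  case (Suc l)
  then have "class_C_plane (Suc (n - Suc l)) ((d_omega ^^ l) u)"
    by (simp add: Suc_diff_Suc)
  then show ?case by simp
qed simp

section \<open>Slices, Fubini and integrability on the cylinder\<close>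

text \<open>The integral over the angle is used in two forms: as a Lebesgue integral for Fubini, and
  as a gauge integral for differentiation under the integral sign and the fundamental theorem of
  calculus.\<close>

lemma integral_slice:
  fixes h :: "real \<Rightarrow> real \<Rightarrow> 'a :: euclidean_space"
  assumes "continuous_on UNIV (\<lambda>(\<theta>, \<omega>). h \<theta> \<omega>)"
  shows "set_integrable lborel {a..b} (\<lambda>\<theta>. h \<theta> \<omega>)"
    and "(LBINT \<theta>. indicator {a..b} \<theta> *\<^sub>R h \<theta> \<omega>) = integral {a..b} (\<lambda>\<theta>. h \<theta> \<omega>)"
proof -
  have "continuous_on {a..b} (\<lambda>\<theta>. h \<theta> \<omega>)"
  proof -
    have "continuous_on {a..b} (\<lambda>\<theta>. (\<theta>, \<omega>))" by (intro continuous_intros)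
    from continuous_on_compose2[OF assms this] show ?thesis by simp
  qed
  then show *: "set_integrable lborel {a..b} (\<lambda>\<theta>. h \<theta> \<omega>)"
    by (rule borel_integrable_atLeastAtMost')
  show "(LBINT \<theta>. indicator {a..b} \<theta> *\<^sub>R h \<theta> \<omega>) = integral {a..b} (\<lambda>\<theta>. h \<theta> \<omega>)"
    using set_borel_integral_eq_integral(2)[OF *] by (simp add: set_lebesgue_integral_def)
qed

lemma continuous_on_integral_slice:
  fixes h :: "real \<Rightarrow> real \<Rightarrow> 'a :: euclidean_space"
  assumes "continuous_on UNIV (\<lambda>(\<theta>, \<omega>). h \<theta> \<omega>)"
  shows "continuous_on UNIV (\<lambda>\<omega>. integral {a..b} (\<lambda>\<theta>. h \<theta> \<omega>))"
proof -
  have "continuous_on (UNIV \<times> cbox a b) (\<lambda>(\<omega>, \<theta>). h \<theta> \<omega>)"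
  proof -
    have "continuous_on (UNIV \<times> cbox a b) (\<lambda>p. (snd p, fst p))" by (intro continuous_intros)
    from continuous_on_compose2[OF assms this] show ?thesis by (simp add: case_prod_unfold)
  qed
  from integral_continuous_on_param[OF this] show ?thesis by simp
qed

lemma indicator_cylinder: "indicator cylinder p = indicator {0..2 * pi} (fst p)"
  by (cases p) (auto simp: cylinder_def indicator_def)

lemma cylinder_measurable [measurable]: "cylinder \<in> sets borel"
  unfolding cylinder_def by (intro borel_closed closed_Times) auto

lemma cylinder_Fubini:
  fixes h :: "real \<Rightarrow> real \<Rightarrow> 'a :: euclidean_space"
  assumes "continuous_on UNIV (\<lambda>(\<theta>, \<omega>). h \<theta> \<omega>)"
    and "set_integrable lborel cylinder (\<lambda>p. h (fst p) (snd p))"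
  shows "integrable lborel (\<lambda>\<omega>. integral {0..2 * pi} (\<lambda>\<theta>. h \<theta> \<omega>))"
    and "(LBINT \<omega>. integral {0..2 * pi} (\<lambda>\<theta>. h \<theta> \<omega>)) = (LINT p:cylinder|lborel. h (fst p) (snd p))"
proof -
  have "integrable (lborel \<Otimes>\<^sub>M lborel) (\<lambda>(\<theta>, \<omega>). indicator {0..2 * pi} \<theta> *\<^sub>R h \<theta> \<omega>)"
    using assms(2) by (simp add: set_integrable_def lborel_prod case_prod_unfold indicator_cylinder)
  from lborel_pair.integrable_snd[OF this] lborel_pair.integral_snd[OF this]
  show "integrable lborel (\<lambda>\<omega>. integral {0..2 * pi} (\<lambda>\<theta>. h \<theta> \<omega>))"
    "(LBINT \<omega>. integral {0..2 * pi} (\<lambda>\<theta>. h \<theta> \<omega>)) = (LINT p:cylinder|lborel. h (fst p) (snd p))"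
    by (simp_all add: integral_slice(2)[OF assms(1)] set_lebesgue_integral_def lborel_prod
        case_prod_unfold indicator_cylinder)
qed

lemma integrable_inverse_1_plus_square_UNIV: "integrable lborel (\<lambda>x::real. inverse (1 + x\<^sup>2))"
  using integrable_inverse_1_plus_square by (simp add: set_integrable_def einterval_def)

text \<open>What the weight in the norms is for: since \<open>\<langle>\<omega>\<rangle>\<^sup>-\<^sup>2\<close> is integrable, they control
  \<open>L\<^sup>1\<close> norms.\<close>

lemma abs_le_bracket: "\<bar>x\<bar> \<le> (bracket \<omega> * x)\<^sup>2 + inverse (1 + \<omega>\<^sup>2)"
proof -
  have pos: "0 < 1 + \<omega>\<^sup>2" by (simp add: add_pos_nonneg)
  define b where "b = bracket \<omega>"
  have b: "b * b = 1 + \<omega>\<^sup>2" "0 < b" using pos by (auto simp: b_def bracket_def)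
  have "2 * \<bar>x\<bar> = 2 * (b * \<bar>x\<bar>) * inverse b" using b by simp
  also have "\<dots> \<le> (b * \<bar>x\<bar>)\<^sup>2 + (inverse b)\<^sup>2"
    by (rule sum_squares_bound)
  also have "(inverse b)\<^sup>2 = inverse (1 + \<omega>\<^sup>2)"
    unfolding b(1)[symmetric] by (simp add: power2_eq_square)
  finally have "2 * \<bar>x\<bar> \<le> (b * x)\<^sup>2 + inverse (1 + \<omega>\<^sup>2)" by (simp add: power_mult_distrib)
  then show ?thesis by (simp add: b_def)
qed

text \<open>Only pure \<omega>-derivatives matter, since all integrations by parts in the decay
  estimate are in \<omega>. The bound of \<open>abs_le_bracket\<close> splits into one term of the
  norm and \<open>inverse (1 + \<omega>\<^sup>2)\<close>, which is integrable on the cylinder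
  because the period is finite.\<close>

lemma set_integrable_cylinder_H_norm:
  assumes "class_C_plane n u" "H_norm_sq_cylinder n u < \<infinity>" "l \<le> n"
  shows "set_integrable lborel cylinder (\<lambda>p. (d_omega ^^ l) u (fst p) (snd p))"
proof -
  define v where "v = (d_omega ^^ l) u"
  have "continuous_on UNIV (\<lambda>(\<theta>, \<omega>). v \<theta> \<omega>)"
    unfolding v_def by (rule class_C_plane_continuous[OF class_C_plane_d_omega[OF assms(1,3)]])
  then have [measurable]: "(\<lambda>p. v (fst p) (snd p)) \<in> borel_measurable borel"
    by (auto simp: case_prod_unfold intro: borel_measurable_continuous_onI)
  have fin: "finite {(k, l). k + l \<le> n}"
    by (rule finite_subset[of _ "{..n} \<times> {..n}"]) auto
  have [measurable]: "(\<lambda>p :: real \<times> real. bracket (snd p)) \<in> borel_measurable borel"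
    unfolding bracket_def by (intro borel_measurable_continuous_onI continuous_intros)
  have [measurable]: "(\<lambda>p :: real \<times> real. inverse (1 + (snd p)\<^sup>2)) \<in> borel_measurable borel"
    by (intro borel_measurable_continuous_onI continuous_intros) (simp add: add_nonneg_eq_0_iff)
  have "(\<integral>\<^sup>+ p \<in> cylinder. ennreal ((bracket (snd p) * v (fst p) (snd p))\<^sup>2) \<partial>lborel) < \<infinity>"
    (is "?I < _")
  proof -
    have "?I \<le> H_norm_sq_cylinder n u"
      unfolding H_norm_sq_cylinder_def v_def
      using member_le_sum[of "(0, l)" "{(k, l). k + l \<le> n}" "\<lambda>(k, l).
        \<integral>\<^sup>+ p \<in> cylinder. ennreal ((bracket (snd p) * (d_theta ^^ k) ((d_omega ^^ l) u) (fst p) (snd p))\<^sup>2) \<partial>lborel"]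
        fin assms(3) by simp
    then show ?thesis using assms(2) by (rule le_less_trans)
  qed
  moreover have "(\<integral>\<^sup>+ p \<in> cylinder. ennreal (inverse (1 + (snd p)\<^sup>2)) \<partial>lborel) < \<infinity>"
  proof -
    have "integrable (lborel \<Otimes>\<^sub>M lborel) (\<lambda>(\<theta>::real, \<omega>::real). indicator {0..2 * pi} \<theta> *\<^sub>R inverse (1 + \<omega>\<^sup>2))"
    proof (rule lborel_pair.Fubini_integrable)
      have "integrable lborel (\<lambda>\<theta>::real. indicator {0..2 * pi} \<theta> *\<^sub>R (LBINT \<omega>::real. inverse (1 + \<omega>\<^sup>2)))"
        by (intro integrable_scaleR_left integrable_real_indicator) auto
      moreover have "norm (case (\<theta>, \<omega>) of (\<theta>, \<omega>) \<Rightarrow> indicator {0..2 * pi} \<theta> *\<^sub>R inverse (1 + \<omega>\<^sup>2)) =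
          indicator {0..2 * pi} \<theta> * inverse (1 + \<omega>\<^sup>2)" for \<theta> \<omega> :: real
        by (simp add: abs_mult add_nonneg_nonneg)
      ultimately show "integrable lborel (\<lambda>\<theta>::real. LBINT \<omega>::real.
          norm (case (\<theta>, \<omega>) of (\<theta>, \<omega>) \<Rightarrow> indicator {0..2 * pi} \<theta> *\<^sub>R inverse (1 + \<omega>\<^sup>2)))"
        by (simp only: integral_mult_right_zero real_scaleR_def)
    qed (use integrable_inverse_1_plus_square_UNIV in \<open>auto\<close>)
    then have "integrable lborel (\<lambda>p::real \<times> real. indicator {0..2 * pi} (fst p) * inverse (1 + (snd p)\<^sup>2))"
      by (simp add: lborel_prod case_prod_unfold)
    then have "(\<integral>\<^sup>+ p. ennreal (norm (indicator {0..2 * pi} (fst p :: real) * inverse (1 + (snd p :: real)\<^sup>2))) \<partial>lborel) < \<infinity>"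
      by (simp add: integrable_iff_bounded)
    moreover have "ennreal (norm (indicator {0..2 * pi} (fst p) * inverse (1 + (snd p)\<^sup>2))) =
        ennreal (inverse (1 + (snd p)\<^sup>2)) * indicator cylinder p" for p :: "real \<times> real"
      by (auto simp: indicator_cylinder split: split_indicator)
    ultimately show ?thesis by simp
  qed
  ultimately have fin2: "(\<integral>\<^sup>+ p \<in> cylinder. ennreal ((bracket (snd p) * v (fst p) (snd p))\<^sup>2) \<partial>lborel) +
      (\<integral>\<^sup>+ p \<in> cylinder. ennreal (inverse (1 + (snd p)\<^sup>2)) \<partial>lborel) < \<infinity>"
    by simp
  have "set_integrable lborel cylinder (\<lambda>p. v (fst p) (snd p))"
    unfolding set_integrable_def
  proof (rule integrableI_bounded)
    have "(\<integral>\<^sup>+ p. ennreal (norm (indicator cylinder p *\<^sub>R v (fst p) (snd p))) \<partial>lborel)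
      \<le> (\<integral>\<^sup>+ p. ennreal ((bracket (snd p) * v (fst p) (snd p))\<^sup>2) * indicator cylinder p +
            ennreal (inverse (1 + (snd p)\<^sup>2)) * indicator cylinder p \<partial>lborel)"
      using abs_le_bracket
      by (intro nn_integral_mono)
         (auto simp: indicator_def add_nonneg_nonneg simp flip: ennreal_plus intro!: ennreal_leI)
    also have "\<dots> = (\<integral>\<^sup>+ p \<in> cylinder. ennreal ((bracket (snd p) * v (fst p) (snd p))\<^sup>2) \<partial>lborel) +
      (\<integral>\<^sup>+ p \<in> cylinder. ennreal (inverse (1 + (snd p)\<^sup>2)) \<partial>lborel)"
      by (intro nn_integral_add) measurable
    finally show "(\<integral>\<^sup>+ p. ennreal (norm (indicator cylinder p *\<^sub>R v (fst p) (snd p))) \<partial>lborel) < \<infinity>"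
      using fin2 by (rule le_less_trans)
  qed measurable
  then show ?thesis by (simp add: v_def)
qed


section \<open>Fourier coefficients in the angle and their decay in frequency\<close>

text \<open>Without a factor \<open>1 / (2 * pi)\<close> the zeroth coefficient of a normalised
  density is 1. Natural \<open>k\<close> suffice: \<open>u\<close> is real, so coefficients of
  opposite index are conjugate.\<close>

definition fourier_coeff :: "(real \<Rightarrow> real \<Rightarrow> real) \<Rightarrow> nat \<Rightarrow> real \<Rightarrow> complex" where
  "fourier_coeff u k \<omega> = integral {0..2 * pi} (\<lambda>\<theta>. complex_of_real (u \<theta> \<omega>) * cis (- (real k * \<theta>)))"

lemma continuous_on_fourier_integrand:
  "continuous_on UNIV (\<lambda>(\<theta>, \<omega>). u \<theta> \<omega>) \<Longrightarrow>
    continuous_on UNIV (\<lambda>(\<theta>, \<omega>). complex_of_real (u \<theta> \<omega>) * cis (- (real k * \<theta>)))"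
  by (auto simp: case_prod_unfold intro!: continuous_intros)

lemma continuous_on_fourier_coeff:
  assumes "continuous_on UNIV (\<lambda>(\<theta>, \<omega>). u \<theta> \<omega>)"
  shows "continuous_on UNIV (fourier_coeff u k)"
  using continuous_on_integral_slice[OF continuous_on_fourier_integrand[OF assms]]
  by (simp add: fourier_coeff_def[abs_def])

lemma norm_fourier_coeff_le:
  assumes "continuous_on UNIV (\<lambda>(\<theta>, \<omega>). u \<theta> \<omega>)"
  shows "norm (fourier_coeff u k \<omega>) \<le> integral {0..2 * pi} (\<lambda>\<theta>. \<bar>u \<theta> \<omega>\<bar>)"
  unfolding fourier_coeff_def
proof (rule Henstock_Kurzweil_Integration.integral_norm_bound_integral)
  show "(\<lambda>\<theta>. complex_of_real (u \<theta> \<omega>) * cis (- (real k * \<theta>))) integrable_on {0..2 * pi}"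
    using integral_slice(1)[OF continuous_on_fourier_integrand[OF assms]]
    by (rule set_borel_integral_eq_integral(1))
  have "continuous_on UNIV (\<lambda>(\<theta>, \<omega>). \<bar>u \<theta> \<omega>\<bar>)"
    using assms by (auto simp: case_prod_unfold intro!: continuous_intros)
  from integral_slice(1)[OF this] show "(\<lambda>\<theta>. \<bar>u \<theta> \<omega>\<bar>) integrable_on {0..2 * pi}"
    by (rule set_borel_integral_eq_integral(1))
qed (simp add: norm_mult)

lemma fourier_coeff_has_vector_derivative:
  assumes "class_C_plane (Suc 0) u"
  shows "(fourier_coeff u k has_vector_derivative fourier_coeff (d_omega u) k \<omega>) (at \<omega>)"
proof -
  have cont: "continuous_on UNIV (\<lambda>(\<theta>, \<omega>). u \<theta> \<omega>)"
    and cont': "continuous_on UNIV (\<lambda>(\<theta>, \<omega>). d_omega u \<theta> \<omega>)"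
    and diff: "(\<lambda>y. u \<theta> y) differentiable (at \<omega>)" for \<theta> \<omega>
    using assms by auto
  have "((\<lambda>\<omega>. integral (cbox 0 (2 * pi)) (\<lambda>\<theta>. complex_of_real (u \<theta> \<omega>) * cis (- (real k * \<theta>))))
     has_vector_derivative
      integral (cbox 0 (2 * pi)) (\<lambda>\<theta>. complex_of_real (d_omega u \<theta> \<omega>) * cis (- (real k * \<theta>)))) (at \<omega> within UNIV)"
  proof (rule leibniz_rule_vector_derivative[where U = UNIV])
    fix x \<theta> :: real
    have "((\<lambda>y. u \<theta> y) has_real_derivative d_omega u \<theta> x) (at x)"
      using diff[of \<theta> x] unfolding d_omega_def
      by (simp add: DERIV_deriv_iff_real_differentiable)
    then show "((\<lambda>x. complex_of_real (u \<theta> x) * cis (- (real k * \<theta>))) has_vector_derivative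
        complex_of_real (d_omega u \<theta> x) * cis (- (real k * \<theta>))) (at x within UNIV)"
      by (intro has_vector_derivative_mult_left has_vector_derivative_of_real)
  next
    fix x
    show "(\<lambda>\<theta>. complex_of_real (u \<theta> x) * cis (- (real k * \<theta>))) integrable_on cbox 0 (2 * pi)"
      using integral_slice(1)[OF continuous_on_fourier_integrand[OF cont], THEN set_borel_integral_eq_integral(1)]
      by simp
  next
    have "continuous_on (UNIV \<times> cbox 0 (2 * pi)) (\<lambda>p :: real \<times> real. (snd p, fst p))"
      by (intro continuous_intros)
    from continuous_on_compose2[OF continuous_on_fourier_integrand[OF cont', of k] this]
    show "continuous_on (UNIV \<times> cbox 0 (2 * pi))
       (\<lambda>(x, \<theta>). complex_of_real (d_omega u \<theta> x) * cis (- (real k * \<theta>)))"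
      by (simp add: case_prod_unfold)
  qed auto
  then show ?thesis by (simp add: fourier_coeff_def[abs_def])
qed

text \<open>The coefficients of an \<omega>-derivative are dominated by the integral of its absolute
  value over \<theta>, which does not involve \<open>k\<close>. Hence one constant, built from the
  derivatives of orders 0 and \<open>n\<close>, serves all modes.\<close>

lemma fourier_coeff_decay:
  assumes u: "class_C_plane n u" and H: "H_norm_sq_cylinder n u < \<infinity>"
  obtains C where "\<And>k \<tau>. (1 + \<bar>\<tau>\<bar>) ^ n * norm (LBINT \<omega>. fourier_coeff u k \<omega> * cis (- (\<tau> * \<omega>))) \<le> C"
proof -
  define v where "v l = (d_omega ^^ l) u" for l
  have cont: "continuous_on UNIV (\<lambda>(\<theta>, \<omega>). v l \<theta> \<omega>)" if "l \<le> n" for l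
    unfolding v_def by (rule class_C_plane_continuous[OF class_C_plane_d_omega[OF u that]])
  define P where "P l = (LBINT \<omega>. integral {0..2 * pi} (\<lambda>\<theta>. \<bar>v l \<theta> \<omega>\<bar>))" for l
  have P: "integrable lborel (\<lambda>\<omega>. integral {0..2 * pi} (\<lambda>\<theta>. \<bar>v l \<theta> \<omega>\<bar>))" if "l \<le> n" for l
  proof (rule cylinder_Fubini(1))
    show "continuous_on UNIV (\<lambda>(\<theta>, \<omega>). \<bar>v l \<theta> \<omega>\<bar>)"
      using cont[OF that] by (auto simp: case_prod_unfold intro!: continuous_intros)
    show "set_integrable lborel cylinder (\<lambda>p. \<bar>v l (fst p) (snd p)\<bar>)"
      using set_integrable_cylinder_H_norm[OF u H that] unfolding v_def by (rule set_integrable_abs)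
  qed
  have int: "integrable lborel (fourier_coeff (v l) k)" if "l \<le> n" for l k
  proof (rule Bochner_Integration.integrable_bound[OF P[OF that]])
    show "fourier_coeff (v l) k \<in> borel_measurable lborel"
      using continuous_on_fourier_coeff[OF cont[OF that]] by (simp add: borel_measurable_continuous_onI)
    show "AE \<omega> in lborel. norm (fourier_coeff (v l) k \<omega>) \<le> norm (integral {0..2 * pi} (\<lambda>\<theta>. \<bar>v l \<theta> \<omega>\<bar>))"
      using norm_fourier_coeff_le[OF cont[OF that]] by (auto intro: order_trans[OF _ abs_ge_self])
  qed
  have le: "(LBINT \<omega>. norm (fourier_coeff (v l) k \<omega>)) \<le> P l" if "l \<le> n" for l k
    unfolding P_def
    by (intro integral_mono integrable_norm int P that norm_fourier_coeff_le cont)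
  have "(1 + \<bar>\<tau>\<bar>) ^ n * norm (LBINT \<omega>. fourier_coeff u k \<omega> * cis (- (\<tau> * \<omega>))) \<le> 2 ^ n * (P 0 + P n)" for k \<tau>
  proof -
    have "(1 + \<bar>\<tau>\<bar>) ^ n * norm (LBINT \<omega>. fourier_coeff (v 0) k \<omega> * cis (- (\<tau> * \<omega>)))
      \<le> 2 ^ n * ((LBINT \<omega>. norm (fourier_coeff (v 0) k \<omega>)) + (LBINT \<omega>. norm (fourier_coeff (v n) k \<omega>)))"
    proof (rule fourier_decay[where G = "\<lambda>l. fourier_coeff (v l) k"])
      fix l :: nat and x :: real
      assume l: "l < n"
      have "class_C_plane (Suc 0) (v l)"
        using class_C_plane_mono[OF class_C_plane_d_omega[OF u, of l], of "Suc 0"] l by (simp add: v_def)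
      moreover have "v (Suc l) = d_omega (v l)" by (simp add: v_def)
      ultimately show "(fourier_coeff (v l) k has_vector_derivative fourier_coeff (v (Suc l)) k x) (at x)"
        by (simp add: fourier_coeff_has_vector_derivative)
    qed (use int continuous_on_fourier_coeff cont in auto)
    also have "\<dots> \<le> 2 ^ n * (P 0 + P n)"
      by (intro mult_left_mono add_mono le) auto
    finally show ?thesis by (simp add: v_def)
  qed
  then show ?thesis by (rule that)
qed

text \<open>This serves the mode 0: a normalised density integrates to 1 over \<theta>, which leaves
  the Fourier transform of \<open>g\<close> alone.\<close>

lemma fourier_decay_H_norm:
  assumes g: "class_C_line n g" and H: "H_norm_sq_line n g < \<infinity>"
  obtains C where "\<And>\<tau>. (1 + \<bar>\<tau>\<bar>) ^ n * norm (LBINT \<omega>. complex_of_real (g \<omega>) * cis (- (\<tau> * \<omega>))) \<le> C"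
proof -
  define v where "v l = (deriv ^^ l) g" for l
  have cont: "continuous_on UNIV (v l)" if "l \<le> n" for l
    using g that by (simp add: class_C_line_def v_def)
  have meas: "v l \<in> borel_measurable borel" if "l \<le> n" for l
    using cont[OF that] by (rule borel_measurable_continuous_onI)
  have meas_br [measurable]: "bracket \<in> borel_measurable borel"
    unfolding bracket_def by measurable
  have int: "integrable lborel (v l)" if "l \<le> n" for l
  proof (rule integrableI_bounded)
    note [measurable] = meas[OF that]
    have "(\<integral>\<^sup>+ \<omega>. ennreal ((bracket \<omega> * v l \<omega>)\<^sup>2) \<partial>lborel) \<le> H_norm_sq_line n g"
      unfolding H_norm_sq_line_def v_def using that
      by (intro member_le_sum[of l "{..n}" "\<lambda>k. \<integral>\<^sup>+ \<omega>. ennreal ((bracket \<omega> * (deriv ^^ k) g \<omega>)\<^sup>2) \<partial>lborel"]) auto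
    then have "(\<integral>\<^sup>+ \<omega>. ennreal ((bracket \<omega> * v l \<omega>)\<^sup>2) \<partial>lborel) < \<infinity>"
      using H by (rule le_less_trans)
    moreover have "(\<integral>\<^sup>+ \<omega>. ennreal (inverse (1 + \<omega>\<^sup>2)) \<partial>lborel) < \<infinity>"
      using integrable_inverse_1_plus_square_UNIV by (simp add: integrable_iff_bounded add_nonneg_nonneg)
    ultimately have "(\<integral>\<^sup>+ \<omega>. ennreal ((bracket \<omega> * v l \<omega>)\<^sup>2) \<partial>lborel) +
        (\<integral>\<^sup>+ \<omega>. ennreal (inverse (1 + \<omega>\<^sup>2)) \<partial>lborel) < \<infinity>" by simp
    also have "(\<integral>\<^sup>+ \<omega>. ennreal ((bracket \<omega> * v l \<omega>)\<^sup>2) \<partial>lborel) +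
        (\<integral>\<^sup>+ \<omega>. ennreal (inverse (1 + \<omega>\<^sup>2)) \<partial>lborel) =
       (\<integral>\<^sup>+ \<omega>. ennreal ((bracket \<omega> * v l \<omega>)\<^sup>2) + ennreal (inverse (1 + \<omega>\<^sup>2)) \<partial>lborel)"
      by (intro nn_integral_add[symmetric]) measurable
    finally have *: "(\<integral>\<^sup>+ \<omega>. ennreal ((bracket \<omega> * v l \<omega>)\<^sup>2) + ennreal (inverse (1 + \<omega>\<^sup>2)) \<partial>lborel) < \<infinity>" .
    have "(\<integral>\<^sup>+ \<omega>. ennreal (norm (v l \<omega>)) \<partial>lborel)
       \<le> (\<integral>\<^sup>+ \<omega>. ennreal ((bracket \<omega> * v l \<omega>)\<^sup>2) + ennreal (inverse (1 + \<omega>\<^sup>2)) \<partial>lborel)"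
      using abs_le_bracket
      by (intro nn_integral_mono)
         (auto simp: add_nonneg_nonneg simp flip: ennreal_plus intro!: ennreal_leI)
    then show "(\<integral>\<^sup>+ \<omega>. ennreal (norm (v l \<omega>)) \<partial>lborel) < \<infinity>"
      using * by (rule le_less_trans)
  qed (use meas[OF that] in simp)
  have "(1 + \<bar>\<tau>\<bar>) ^ n * norm (LBINT \<omega>. complex_of_real (v 0 \<omega>) * cis (- (\<tau> * \<omega>)))
    \<le> 2 ^ n * ((LBINT \<omega>. norm (complex_of_real (v 0 \<omega>))) + (LBINT \<omega>. norm (complex_of_real (v n \<omega>))))" for \<tau>
  proof (rule fourier_decay[where G = "\<lambda>l \<omega>. complex_of_real (v l \<omega>)"])
    fix l :: nat and x :: real
    assume "l < n"
    then have "(v l has_real_derivative v (Suc l) x) (at x)"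
      using g by (simp add: class_C_line_def v_def DERIV_deriv_iff_real_differentiable)
    then show "((\<lambda>\<omega>. complex_of_real (v l \<omega>)) has_vector_derivative complex_of_real (v (Suc l) x)) (at x)"
      by (rule has_vector_derivative_of_real)
  qed (use int cont in \<open>auto intro!: continuous_intros integrable_of_real\<close>)
  then show ?thesis by (intro that) (simp add: v_def)
qed

section \<open>Continuity, exchange of integrals and integrability for the moments\<close>

lemma continuous_on_LBINT:
  fixes h :: "'a :: metric_space \<Rightarrow> real \<Rightarrow> complex"
  assumes cont: "\<And>\<omega>. continuous_on U (\<lambda>x. h x \<omega>)"
    and meas: "\<And>x. x \<in> U \<Longrightarrow> h x \<in> borel_measurable borel"
    and w: "integrable lborel w" and le: "\<And>x \<omega>. x \<in> U \<Longrightarrow> norm (h x \<omega>) \<le> w \<omega>"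
  shows "continuous_on U (\<lambda>x. LBINT \<omega>. h x \<omega>)"
  unfolding continuous_on_sequentially
proof (intro allI ballI impI)
  fix X a
  assume a: "a \<in> U" and X: "(\<forall>n. X n \<in> U) \<and> X \<longlonglongrightarrow> a"
  have "(\<lambda>n. LBINT \<omega>. h (X n) \<omega>) \<longlonglongrightarrow> (LBINT \<omega>. h a \<omega>)"
  proof (rule integral_dominated_convergence[OF _ _ w])
    show "AE \<omega> in lborel. (\<lambda>n. h (X n) \<omega>) \<longlonglongrightarrow> h a \<omega>"
      using cont a X unfolding continuous_on_sequentially o_def by (intro AE_I2) blast
  qed (use meas le a X in auto)
  then show "((\<lambda>x. LBINT \<omega>. h x \<omega>) \<circ> X) \<longlonglongrightarrow> (LBINT \<omega>. h a \<omega>)"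
    by (simp add: o_def)
qed

text \<open>This allows the evolution to be integrated in time at fixed \<omega> first and averaged
  with \<open>g\<close> afterwards.\<close>

lemma LBINT_integral_swap:
  fixes h :: "real \<Rightarrow> real \<Rightarrow> complex" and g :: "real \<Rightarrow> real"
  assumes h: "continuous_on ({0..t} \<times> UNIV) (\<lambda>(s, \<omega>). h s \<omega>)"
    and le: "\<And>s \<omega>. s \<in> {0..t} \<Longrightarrow> norm (h s \<omega>) \<le> M"
    and g: "integrable lborel g" and t: "0 \<le> t"
    and cont: "continuous_on {0..t} (\<lambda>s. LBINT \<omega>. complex_of_real (g \<omega>) * h s \<omega>)"
  shows "(LBINT \<omega>. complex_of_real (g \<omega>) * integral {0..t} (\<lambda>s. h s \<omega>)) =
      integral {0..t} (\<lambda>s. LBINT \<omega>. complex_of_real (g \<omega>) * h s \<omega>)"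
proof -
  \<comment> \<open>\<open>h\<close> is controlled on \<open>{0..t}\<close> only. Its extension by 0
    is measurable on the plane and dominated by \<open>M\<close> times an indicator, so Fubini
    applies to the product with \<open>g\<close>.\<close>
  define H where "H p = indicator ({0..t} \<times> UNIV) p *\<^sub>R (case p of (s, \<omega>) \<Rightarrow> h s \<omega>)" for p :: "real \<times> real"
  have [measurable]: "H \<in> borel_measurable borel"
    unfolding H_def[abs_def]
    by (rule borel_measurable_continuous_on_indicator[OF _ h]) (intro borel_closed closed_Times, auto)
  then have [measurable]: "H \<in> borel_measurable (borel \<Otimes>\<^sub>M borel)"
    by (simp add: borel_prod)
  have [measurable]: "g \<in> borel_measurable borel" using g by auto
  have H_eq: "H (s, \<omega>) = indicator {0..t} s *\<^sub>R h s \<omega>" for s \<omega>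
    by (auto simp: H_def indicator_def)
  have M: "0 \<le> M" using le[of 0] t by (auto intro: order_trans[OF norm_ge_zero])
  have Hle: "norm (H (s, \<omega>)) \<le> indicator {0..t} s * M" for s \<omega>
    using le[of s \<omega>] by (auto simp: H_eq indicator_def)
  have int_s: "integrable lborel (\<lambda>\<omega>. complex_of_real (g \<omega>) * H (s, \<omega>))" for s
  proof (rule Bochner_Integration.integrable_bound)
    show "integrable lborel (\<lambda>\<omega>. M * g \<omega>)" using g by simp
    show "AE \<omega> in lborel. norm (complex_of_real (g \<omega>) * H (s, \<omega>)) \<le> norm (M * g \<omega>)"
    proof (intro AE_I2)
      fix \<omega>
      have "norm (H (s, \<omega>)) \<le> M"
        using Hle[of s \<omega>] M by (cases "s \<in> {0..t}") (simp_all add: H_eq)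
      then show "norm (complex_of_real (g \<omega>) * H (s, \<omega>)) \<le> norm (M * g \<omega>)"
        using M by (simp add: norm_mult abs_mult mult.commute[of M] mult_left_mono)
    qed
  qed measurable
  have int2: "integrable (lborel \<Otimes>\<^sub>M lborel) (\<lambda>(s, \<omega>). complex_of_real (g \<omega>) * H (s, \<omega>))"
  proof (rule lborel_pair.Fubini_integrable)
    show "integrable lborel (\<lambda>s. LBINT \<omega>. norm (case (s, \<omega>) of (s, \<omega>) \<Rightarrow> complex_of_real (g \<omega>) * H (s, \<omega>)))"
    proof (rule Bochner_Integration.integrable_bound)
      show "integrable lborel (\<lambda>s::real. indicator {0..t} s *\<^sub>R (LBINT \<omega>. M * norm (g \<omega>)))"
        using t by (intro integrable_scaleR_left integrable_real_indicator) auto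
      show "AE s in lborel. norm (LBINT \<omega>. norm (case (s, \<omega>) of (s, \<omega>) \<Rightarrow> complex_of_real (g \<omega>) * H (s, \<omega>)))
          \<le> norm (indicator {0..t} s *\<^sub>R (LBINT \<omega>. M * norm (g \<omega>)))"
      proof (intro AE_I2)
        fix s :: real
        have "(LBINT \<omega>. norm (complex_of_real (g \<omega>) * H (s, \<omega>))) \<le> (LBINT \<omega>. indicator {0..t} s * (M * norm (g \<omega>)))"
        proof (rule integral_mono)
          show "norm (complex_of_real (g \<omega>) * H (s, \<omega>)) \<le> indicator {0..t} s * (M * norm (g \<omega>))" for \<omega>
            using mult_left_mono[OF Hle[of s \<omega>], of "\<bar>g \<omega>\<bar>"] by (simp add: norm_mult mult_ac)
        qed (use int_s g in auto)
        also have "\<dots> = indicator {0..t} s * (LBINT \<omega>. M * norm (g \<omega>))"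
          by (rule integral_mult_right_zero)
        finally show "norm (LBINT \<omega>. norm (case (s, \<omega>) of (s, \<omega>) \<Rightarrow> complex_of_real (g \<omega>) * H (s, \<omega>)))
          \<le> norm (indicator {0..t} s *\<^sub>R (LBINT \<omega>. M * norm (g \<omega>)))"
          using M by simp
      qed
    qed measurable
  qed (use int_s in auto)
  have slice: "(LBINT s. H (s, \<omega>)) = integral {0..t} (\<lambda>s. h s \<omega>)" for \<omega>
  proof -
    have "continuous_on {0..t} (\<lambda>s. (s, \<omega>))" by (intro continuous_intros)
    from continuous_on_compose2[OF h this] have "continuous_on {0..t} (\<lambda>s. h s \<omega>)" by auto
    from set_borel_integral_eq_integral(2)[OF borel_integrable_atLeastAtMost'[OF this]]
    show ?thesis by (simp add: set_lebesgue_integral_def H_eq)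
  qed
  have "(LBINT \<omega>. complex_of_real (g \<omega>) * integral {0..t} (\<lambda>s. h s \<omega>)) =
      (LBINT \<omega>. LBINT s. complex_of_real (g \<omega>) * H (s, \<omega>))"
    by (simp add: slice)
  also have "\<dots> = (LBINT s. LBINT \<omega>. complex_of_real (g \<omega>) * H (s, \<omega>))"
    by (rule lborel_pair.Fubini_integral[OF int2])
  also have "\<dots> = (LBINT s. indicator {0..t} s *\<^sub>R (LBINT \<omega>. complex_of_real (g \<omega>) * h s \<omega>))"
    by (intro Bochner_Integration.integral_cong refl) (auto simp: H_eq indicator_def)
  also have "\<dots> = integral {0..t} (\<lambda>s. LBINT \<omega>. complex_of_real (g \<omega>) * h s \<omega>)"
    using set_borel_integral_eq_integral(2)[OF borel_integrable_atLeastAtMost'[OF cont]]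
    by (simp add: set_lebesgue_integral_def)
  finally show ?thesis .
qed

lemma has_vector_derivative_cis_linear:
  "((\<lambda>x. cis (a * x + b)) has_vector_derivative (\<i> * of_real a * cis (a * x + b))) (at x within S)"
proof -
  have "((\<lambda>x. cis (a * x + b)) has_derivative (\<lambda>t. (a * t) *\<^sub>R (\<i> * cis (a * x + b)))) (at x within S)"
    by (rule has_derivative_cis) (auto intro!: derivative_eq_intros)
  then show ?thesis
    unfolding has_vector_derivative_def by (simp add: scaleR_conv_of_real mult_ac)
qed

lemma fourier_coeff_const:
  assumes "0 < k"
  shows "fourier_coeff (\<lambda>\<theta> \<omega>. c) k \<omega> = 0"
proof -
  \<comment> \<open>An antiderivative, as \<open>\<i> / k\<close> is the inverse of
    \<open>- \<i> * k\<close>. The phase is written with \<open>+ 0\<close> to have the form in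
    \<open>has_vector_derivative_cis_linear\<close>; periodicity makes the boundary terms
    cancel.\<close>
  let ?F = "\<lambda>\<theta>. complex_of_real c * (\<i> / of_nat k * cis ((- real k) * \<theta> + 0))"
  have "((\<lambda>\<theta>. complex_of_real c * cis (- (real k * \<theta>))) has_integral (?F (2 * pi) - ?F 0)) {0..2 * pi}"
  proof (rule fundamental_theorem_of_calculus)
    fix x :: real
    show "(?F has_vector_derivative complex_of_real c * cis (- (real k * x))) (at x within {0..2 * pi})"
    proof (rule has_vector_derivative_eq_rhs)
      show "(?F has_vector_derivative complex_of_real c * (\<i> / of_nat k * (\<i> * of_real (- real k) * cis ((- real k) * x + 0)))) (at x within {0..2 * pi})"
        by (intro has_vector_derivative_mult_right has_vector_derivative_cis_linear)
    qed (use assms in simp)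
  qed simp
  moreover have "cis (- (real k * (2 * pi))) = 1"
    using cis_multiple_2pi[of "- of_nat k"] by (simp add: mult_ac)
  ultimately have "((\<lambda>\<theta>. complex_of_real c * cis (- (real k * \<theta>))) has_integral 0) {0..2 * pi}"
    by simp
  then show ?thesis
    unfolding fourier_coeff_def by (rule integral_unique)
qed

lemma fourier_coeff_add_const:
  assumes "0 < k" and cont: "continuous_on UNIV (\<lambda>(\<theta>, \<omega>). u \<theta> \<omega>)"
  shows "fourier_coeff (\<lambda>\<theta> \<omega>. c + u \<theta> \<omega>) k \<omega> = fourier_coeff u k \<omega>"
proof -
  have int: "(\<lambda>\<theta>. complex_of_real (v \<theta> \<omega>) * cis (- (real k * \<theta>))) integrable_on {0..2 * pi}"
    if "continuous_on UNIV (\<lambda>(\<theta>, \<omega>). v \<theta> \<omega>)" for v :: "real \<Rightarrow> real \<Rightarrow> real"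
    using integral_slice(1)[OF continuous_on_fourier_integrand[OF that]]
    by (rule set_borel_integral_eq_integral(1))
  have "fourier_coeff (\<lambda>\<theta> \<omega>. c + u \<theta> \<omega>) k \<omega> = fourier_coeff (\<lambda>\<theta> \<omega>. c) k \<omega> + fourier_coeff u k \<omega>"
    unfolding fourier_coeff_def
    using Henstock_Kurzweil_Integration.integral_add[OF int[of "\<lambda>\<theta> \<omega>. c"] int[OF cont]]
    by (simp add: case_prod_unfold algebra_simps)
  then show ?thesis by (simp add: fourier_coeff_const[OF assms(1)])
qed

lemma fourier_coeff_mult:
  "fourier_coeff (\<lambda>\<theta> \<omega>. u \<theta> \<omega> * g \<omega>) k \<omega> = complex_of_real (g \<omega>) * fourier_coeff u k \<omega>"
  unfolding fourier_coeff_def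
  by (subst Henstock_Kurzweil_Integration.integral_mult_right[symmetric]) (simp add: mult_ac)

text \<open>For each \<omega> the nonnegative \<open>u\<close> has mass 1 over \<theta>, so the
  integral of the absolute value is that of \<open>\<bar>g \<omega>\<bar>\<close>. For this \<theta>
  must be the inner variable, hence the swap of coordinates at the end.\<close>

lemma set_integrable_density_mult:
  fixes u :: "real \<Rightarrow> real \<Rightarrow> real"
  assumes u: "normalised_density u" and cont: "continuous_on UNIV (\<lambda>(\<theta>, \<omega>). u \<theta> \<omega>)"
    and g: "integrable lborel g" and gc: "continuous_on UNIV g"
  shows "set_integrable lborel cylinder (\<lambda>p. u (fst p) (snd p) * g (snd p))"
proof -
  have [measurable]: "(\<lambda>p. u (fst p) (snd p)) \<in> borel_measurable (borel \<Otimes>\<^sub>M borel)"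
    using cont unfolding borel_prod by (auto simp: case_prod_unfold intro: borel_measurable_continuous_onI)
  then have [measurable]: "(\<lambda>p. u (snd p) (fst p)) \<in> borel_measurable (borel \<Otimes>\<^sub>M borel)"
    using measurable_compose[OF measurable_pair_swap' \<open>(\<lambda>p. u (fst p) (snd p)) \<in> _\<close>]
    by (simp add: case_prod_unfold)
  have [measurable]: "g \<in> borel_measurable borel"
    using g by auto
  have int_u: "integrable lborel (\<lambda>\<theta>. indicator {0..2 * pi} \<theta> * u \<theta> \<omega>)" for \<omega>
    using integral_slice(1)[OF cont] by (simp add: set_integrable_def)
  have one: "(LBINT \<theta>. indicator {0..2 * pi} \<theta> * u \<theta> \<omega>) = 1" for \<omega>
    using u by (simp add: normalised_density_def set_lebesgue_integral_def)
  have "integrable (lborel \<Otimes>\<^sub>M lborel) (\<lambda>(\<omega>, \<theta>). indicator {0..2 * pi} \<theta> * u \<theta> \<omega> * g \<omega>)"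
  proof (rule lborel_pair.Fubini_integrable)
    have "(LBINT \<theta>. norm (indicator {0..2 * pi} \<theta> * u \<theta> \<omega> * g \<omega>)) = \<bar>g \<omega>\<bar>" for \<omega>
    proof -
      have "norm (indicator {0..2 * pi} \<theta> * u \<theta> \<omega> * g \<omega>) = indicator {0..2 * pi} \<theta> * u \<theta> \<omega> * \<bar>g \<omega>\<bar>" for \<theta>
        using u by (simp add: normalised_density_def abs_mult)
      then show ?thesis using one[of \<omega>] by simp
    qed
    then show "integrable lborel (\<lambda>\<omega>. LBINT \<theta>. norm (case (\<omega>, \<theta>) of (\<omega>, \<theta>) \<Rightarrow>
        indicator {0..2 * pi} \<theta> * u \<theta> \<omega> * g \<omega>))"
      using g by simp
  qed (use int_u in \<open>simp_all add: case_prod_unfold\<close>)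
  from lborel_pair.integrable_product_swap[OF this]
  show ?thesis
    unfolding set_integrable_def by (simp add: case_prod_unfold lborel_prod indicator_cylinder mult.assoc)
qed

subsection \<open>Fourier modes of a solution\<close>

locale kuramoto =
  fixes n :: nat and g :: "real \<Rightarrow> real" and K :: real and \<rho> :: "real \<Rightarrow> real \<Rightarrow> real \<Rightarrow> real"
  assumes n_pos: "0 < n" and g: "probability_density g" and g_cont: "continuous_on UNIV g"
    and solution: "kuramoto_solution n g K \<rho>"
begin

text \<open>The function f_k(t, \<tau>) of the introduction. The phase
  \<open>real k * t * \<omega>\<close> undoes free transport, which multiplies the mode
  \<open>k\<close> at frequency \<omega> by \<open>cis (- (real k * t * \<omega>))\<close>.\<close>

definition moment :: "nat \<Rightarrow> real \<Rightarrow> real \<Rightarrow> complex" where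
  "moment k t \<tau> = (LBINT \<omega>. complex_of_real (g \<omega>) * (fourier_coeff (\<rho> t) k \<omega> * cis (real k * t * \<omega> - \<tau> * \<omega>)))"

text \<open>At \<open>k = 1\<close> and \<open>\<tau> = t\<close> the phase vanishes, which leaves
  the first Fourier mode of the density averaged with \<open>g\<close>.\<close>

definition R :: "real \<Rightarrow> complex" where
  "R t = moment 1 t t"

lemma g_nonneg: "0 \<le> g \<omega>" and g_int: "integrable lborel g" and g_one: "(LBINT \<omega>. g \<omega>) = 1"
  using g by (auto simp: probability_density_def)

lemma density: "0 \<le> t \<Longrightarrow> normalised_density (\<rho> t)"
  and class_C: "0 \<le> t \<Longrightarrow> class_C_plane n (\<rho> t)"
  and periodic: "0 \<le> t \<Longrightarrow> \<rho> t (\<theta> + 2 * pi) \<omega> = \<rho> t \<theta> \<omega>"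
  and joint_cont: "k + l \<le> n \<Longrightarrow>
    continuous_on ({0..} \<times> UNIV) (\<lambda>(t, \<theta>, \<omega>). (d_theta ^^ k) ((d_omega ^^ l) (\<rho> t)) \<theta> \<omega>)"
  using solution by (auto simp: kuramoto_solution_def class_C_cylinder_def)

lemma cont_\<rho>: "continuous_on ({0..} \<times> UNIV) (\<lambda>(t, \<theta>, \<omega>). \<rho> t \<theta> \<omega>)"
  using joint_cont[of 0 0] by simp

lemma cont_d_theta: "continuous_on ({0..} \<times> UNIV) (\<lambda>(t, \<theta>, \<omega>). d_theta (\<rho> t) \<theta> \<omega>)"
  using joint_cont[of 1 0] n_pos by simp

lemma cont_slice: "0 \<le> t \<Longrightarrow> continuous_on UNIV (\<lambda>(\<theta>, \<omega>). \<rho> t \<theta> \<omega>)"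
  using class_C_plane_continuous[OF class_C] .

text \<open>Positivity and unit mass over \<theta> hold at all times. They are the source of the
  bound 1, uniform in \<open>k\<close> and \<open>t\<close>, from which the iteration in
  \<open>hierarchy_bound\<close> starts.\<close>

lemma fourier_coeff_0: "0 \<le> t \<Longrightarrow> fourier_coeff (\<rho> t) 0 \<omega> = 1"
  and norm_fourier_coeff: "0 \<le> t \<Longrightarrow> norm (fourier_coeff (\<rho> t) k \<omega>) \<le> 1"
proof -
  assume t: "0 \<le> t"
  have i: "integral {0..2 * pi} (\<lambda>\<theta>. \<rho> t \<theta> \<omega>) = 1"
    using density[OF t] integral_slice(2)[OF cont_slice[OF t], of 0 "2 * pi" \<omega>]
    by (simp add: normalised_density_def set_lebesgue_integral_def)
  have "(\<lambda>\<theta>. \<rho> t \<theta> \<omega>) integrable_on {0..2 * pi}"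
    using integral_slice(1)[OF cont_slice[OF t]] by (rule set_borel_integral_eq_integral(1))
  then show "fourier_coeff (\<rho> t) 0 \<omega> = 1"
    using i integral_linear[of "\<lambda>\<theta>. \<rho> t \<theta> \<omega>" "{0..2 * pi}" complex_of_real] bounded_linear_of_real
    by (simp add: fourier_coeff_def o_def)
  have "norm (fourier_coeff (\<rho> t) k \<omega>) \<le> integral {0..2 * pi} (\<lambda>\<theta>. \<bar>\<rho> t \<theta> \<omega>\<bar>)"
    by (rule norm_fourier_coeff_le[OF cont_slice[OF t]])
  also have "(\<lambda>\<theta>. \<bar>\<rho> t \<theta> \<omega>\<bar>) = (\<lambda>\<theta>. \<rho> t \<theta> \<omega>)"
    using density[OF t] by (simp add: normalised_density_def)
  finally show "norm (fourier_coeff (\<rho> t) k \<omega>) \<le> 1" by (simp add: i)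
qed

lemma cont_fourier_coeff: "continuous_on ({0..} \<times> UNIV) (\<lambda>(t, \<omega>). fourier_coeff (\<rho> t) k \<omega>)"
proof -
  have "continuous_on (({0..} \<times> UNIV) \<times> cbox 0 (2 * pi)) (\<lambda>p :: (real \<times> real) \<times> real. (fst (fst p), snd p, snd (fst p)))"
    by (intro continuous_intros)
  from continuous_on_compose2[OF cont_\<rho> this]
  have "continuous_on (({0..} \<times> UNIV) \<times> cbox 0 (2 * pi)) (\<lambda>p :: (real \<times> real) \<times> real. \<rho> (fst (fst p)) (snd p) (snd (fst p)))"
    by (simp add: image_subset_iff)
  then have "continuous_on (({0..} \<times> UNIV) \<times> cbox 0 (2 * pi))
     (\<lambda>(x, \<theta>). complex_of_real (\<rho> (fst x) \<theta> (snd x)) * cis (- (real k * \<theta>)))"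
    by (auto simp: case_prod_unfold intro!: continuous_intros)
  from integral_continuous_on_param[OF this] show ?thesis
    by (simp add: fourier_coeff_def case_prod_unfold)
qed

lemma cont_fourier_coeff_time: "continuous_on {0..} (\<lambda>t. fourier_coeff (\<rho> t) k \<omega>)"
proof -
  have "continuous_on {0..} (\<lambda>t::real. (t, \<omega>))" by (intro continuous_intros)
  from continuous_on_compose2[OF cont_fourier_coeff this] show ?thesis by auto
qed

lemma measurable_moment:
  "0 \<le> t \<Longrightarrow> (\<lambda>\<omega>. complex_of_real (g \<omega>) * (fourier_coeff (\<rho> t) k \<omega> * cis (a * \<omega> - b * \<omega>))) \<in> borel_measurable borel"
  by (intro borel_measurable_continuous_onI continuous_intros continuous_on_fourier_coeff cont_slice g_cont)

lemma integrable_moment: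
  assumes "0 \<le> t"
  shows "integrable lborel (\<lambda>\<omega>. complex_of_real (g \<omega>) * (fourier_coeff (\<rho> t) k \<omega> * cis (a * \<omega> - b * \<omega>)))"
proof (rule Bochner_Integration.integrable_bound[OF g_int])
  show "AE \<omega> in lborel. norm (complex_of_real (g \<omega>) * (fourier_coeff (\<rho> t) k \<omega> * cis (a * \<omega> - b * \<omega>))) \<le> norm (g \<omega>)"
    using mult_left_mono[OF norm_fourier_coeff[OF assms] g_nonneg]
    by (intro AE_I2) (simp add: norm_mult g_nonneg)
qed (use measurable_moment[OF assms] in simp)

lemma norm_moment: "0 \<le> t \<Longrightarrow> norm (moment k t \<tau>) \<le> 1"
proof -
  assume t: "0 \<le> t"
  have "norm (moment k t \<tau>) \<le> (LBINT \<omega>. g \<omega>)"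
    unfolding moment_def
  proof (rule Bochner_Integration.integral_norm_bound_integral[OF integrable_moment[OF t] g_int])
    show "norm (complex_of_real (g \<omega>) * (fourier_coeff (\<rho> t) k \<omega> * cis (real k * t * \<omega> - \<tau> * \<omega>))) \<le> g \<omega>" for \<omega>
      using mult_left_mono[OF norm_fourier_coeff[OF t] g_nonneg] by (simp add: norm_mult g_nonneg)
  qed
  then show ?thesis by (simp add: g_one)
qed

lemma cont_moment: "continuous_on ({0..} \<times> UNIV) (\<lambda>(t, \<tau>). moment k t \<tau>)"
  unfolding moment_def case_prod_unfold
proof (rule continuous_on_LBINT[OF _ _ g_int])
  fix \<omega>
  have "continuous_on ({0..} \<times> UNIV) (\<lambda>p. fourier_coeff (\<rho> (fst p)) k \<omega>)"
    by (rule continuous_on_compose2[OF cont_fourier_coeff_time]) (auto intro!: continuous_intros)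
  then show "continuous_on ({0..} \<times> UNIV)
     (\<lambda>p. complex_of_real (g \<omega>) * (fourier_coeff (\<rho> (fst p)) k \<omega> * cis (real k * fst p * \<omega> - snd p * \<omega>)))"
    by (intro continuous_intros)
next
  fix p :: "real \<times> real" and \<omega>
  assume "p \<in> {0..} \<times> UNIV"
  then have t: "0 \<le> fst p" by auto
  show "(\<lambda>\<omega>. complex_of_real (g \<omega>) * (fourier_coeff (\<rho> (fst p)) k \<omega> * cis (real k * fst p * \<omega> - snd p * \<omega>)))
      \<in> borel_measurable borel"
    by (rule measurable_moment[OF t])
  show "norm (complex_of_real (g \<omega>) * (fourier_coeff (\<rho> (fst p)) k \<omega> * cis (real k * fst p * \<omega> - snd p * \<omega>))) \<le> g \<omega>"
    using mult_left_mono[OF norm_fourier_coeff[OF t] g_nonneg] by (simp add: norm_mult g_nonneg)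
qed

text \<open>The zeroth mode remains the Fourier transform of \<open>g\<close>, so its decay at time
  0 is its decay at all times.\<close>

lemma moment_0: "0 \<le> t \<Longrightarrow> moment 0 t \<tau> = moment 0 0 \<tau>"
  by (simp add: moment_def fourier_coeff_0)

lemma moment_comp_cont:
  assumes "continuous_on S \<sigma>" "continuous_on S \<eta>" "\<And>s. s \<in> S \<Longrightarrow> 0 \<le> \<eta> s"
  shows "continuous_on S (\<lambda>s. moment k (\<eta> s) (\<sigma> s))"
proof -
  have "continuous_on S (\<lambda>s. (\<eta> s, \<sigma> s))" using assms by (intro continuous_intros)
  from continuous_on_compose2[OF cont_moment this] show ?thesis using assms by auto
qed

lemma cont_R: "continuous_on {0..} R"
  unfolding R_def[abs_def] by (rule moment_comp_cont) (auto intro!: continuous_intros)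

text \<open>Stated for an arbitrary normalised density because it is applied both to the solution
  and to the uniform density.\<close>

lemma cylinder_integral:
  fixes u :: "real \<Rightarrow> real \<Rightarrow> real"
  assumes u: "normalised_density u" and cont: "continuous_on UNIV (\<lambda>(\<theta>, \<omega>). u \<theta> \<omega>)"
  shows "set_integrable lborel cylinder (\<lambda>p. complex_of_real (u (fst p) (snd p) * g (snd p)) * cis (- fst p))"
    and "(LINT p:cylinder|lborel. complex_of_real (u (fst p) (snd p) * g (snd p)) * cis (- fst p)) =
      (LBINT \<omega>. complex_of_real (g \<omega>) * fourier_coeff u 1 \<omega>)"
proof -
  have gs: "continuous_on UNIV (\<lambda>p :: real \<times> real. g (snd p))"
    by (rule continuous_on_compose2[OF g_cont]) (auto intro!: continuous_intros)
  then have c: "continuous_on UNIV (\<lambda>(\<theta>, \<omega>). complex_of_real (u \<theta> \<omega> * g \<omega>) * cis (- \<theta>))"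
    using cont by (auto simp: case_prod_unfold intro!: continuous_intros)
  have cm: "(\<lambda>p. complex_of_real (u (fst p) (snd p) * g (snd p)) * cis (- fst p)) \<in> borel_measurable borel"
    using borel_measurable_continuous_onI[OF c] by (simp add: case_prod_unfold)
  show *: "set_integrable lborel cylinder (\<lambda>p. complex_of_real (u (fst p) (snd p) * g (snd p)) * cis (- fst p))"
    unfolding set_integrable_def
  proof (rule Bochner_Integration.integrable_bound)
    show "integrable lborel (\<lambda>p. indicator cylinder p *\<^sub>R (u (fst p) (snd p) * g (snd p)))"
      using set_integrable_density_mult[OF u cont g_int g_cont] by (simp add: set_integrable_def)
    show "(\<lambda>p. indicator cylinder p *\<^sub>R (complex_of_real (u (fst p) (snd p) * g (snd p)) * cis (- fst p)))
      \<in> borel_measurable lborel"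
      using cm cylinder_measurable by (auto intro!: borel_measurable_scaleR borel_measurable_indicator)
  qed (auto simp: norm_mult abs_mult indicator_def)
  have "integral {0..2 * pi} (\<lambda>\<theta>. complex_of_real (u \<theta> \<omega> * g \<omega>) * cis (- \<theta>)) =
      complex_of_real (g \<omega>) * fourier_coeff u 1 \<omega>" for \<omega>
    unfolding fourier_coeff_def by (subst Henstock_Kurzweil_Integration.integral_mult_right[symmetric]) (simp add: mult_ac)
  then show "(LINT p:cylinder|lborel. complex_of_real (u (fst p) (snd p) * g (snd p)) * cis (- fst p)) =
      (LBINT \<omega>. complex_of_real (g \<omega>) * fourier_coeff u 1 \<omega>)"
    using cylinder_Fubini(2)[OF c *] by simp
qed

lemma R_eq:
  assumes "0 \<le> t"
  shows "R t = (LINT p:cylinder|lborel. complex_of_real (\<rho> t (fst p) (snd p) * g (snd p)) * cis (- fst p))"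
  using cylinder_integral(2)[OF density[OF assms] cont_slice[OF assms]]
  by (simp add: R_def moment_def)

lemma order_parameter_eq_R:
  assumes "0 \<le> t"
  shows "order_parameter g (\<lambda>\<theta> \<omega>. \<rho> t \<theta> \<omega> - 1 / (2 * pi)) = R t"
proof -
  \<comment> \<open>The uniform density is itself normalised, so both parts of the difference are
    integrable; its first Fourier mode is 0.\<close>
  define c :: "real \<Rightarrow> real \<Rightarrow> real" where "c \<theta> \<omega> = 1 / (2 * pi)" for \<theta> \<omega>
  have dens: "normalised_density c"
    by (simp add: normalised_density_def c_def set_lebesgue_integral_def)
  have cc: "continuous_on UNIV (\<lambda>(\<theta>, \<omega>). c \<theta> \<omega>)"
    by (simp add: c_def case_prod_unfold)
  have "order_parameter g (\<lambda>\<theta> \<omega>. \<rho> t \<theta> \<omega> - 1 / (2 * pi)) = (LINT p:cylinder|lborel.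
      complex_of_real (\<rho> t (fst p) (snd p) * g (snd p)) * cis (- fst p) -
      complex_of_real (c (fst p) (snd p) * g (snd p)) * cis (- fst p))"
    unfolding order_parameter_def
    by (intro arg_cong2[where f = "set_lebesgue_integral lborel"] refl ext)
       (simp add: c_def cis_conv_exp algebra_simps)
  also have "\<dots> = R t - (LBINT \<omega>. complex_of_real (g \<omega>) * fourier_coeff c 1 \<omega>)"
    unfolding R_eq[OF assms] cylinder_integral(2)[OF dens cc, symmetric]
    by (rule set_integral_diff(2)[OF cylinder_integral(1)[OF density[OF assms] cont_slice[OF assms]]
        cylinder_integral(1)[OF dens cc]])
  also have "\<dots> = R t"
    using fourier_coeff_const[of 1 "1 / (2 * pi)"] by (simp add: c_def[abs_def])
  finally show ?thesis .
qed

text \<open>\<open>sin (\<vartheta> - \<theta>)\<close> is the imaginary part of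
  \<open>cis (- \<theta>) * cnj (cis (- \<vartheta>))\<close>. The integral is therefore the image
  of \<open>R t\<close> under a map that is bounded and linear over the reals, and such a map
  commutes with integration.\<close>

lemma kuramoto_V_eq:
  assumes "0 \<le> t"
  shows "kuramoto_V g K (\<rho> t) \<theta> = K * Im (cis (- \<theta>) * cnj (R t))"
proof -
  define T where "T z = Im (cis (- \<theta>) * cnj z)" for z
  have T: "bounded_linear T"
    unfolding T_def
    by (intro bounded_linear_compose[OF bounded_linear_Im]
        bounded_linear_compose[OF bounded_linear_mult_right] bounded_linear_cnj)
  have "(LINT p:cylinder|lborel. sin (fst p - \<theta>) * \<rho> t (fst p) (snd p) * g (snd p)) =
     (LBINT p. T (indicator cylinder p *\<^sub>R (complex_of_real (\<rho> t (fst p) (snd p) * g (snd p)) * cis (- fst p))))"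
    unfolding set_lebesgue_integral_def
  proof (intro Bochner_Integration.integral_cong refl)
    fix p :: "real \<times> real"
    have "T (complex_of_real (\<rho> t (fst p) (snd p) * g (snd p)) * cis (- fst p)) =
        sin (fst p - \<theta>) * \<rho> t (fst p) (snd p) * g (snd p)"
      by (simp add: T_def cis_cnj sin_diff algebra_simps)
    then show "indicator cylinder p *\<^sub>R (sin (fst p - \<theta>) * \<rho> t (fst p) (snd p) * g (snd p)) =
      T (indicator cylinder p *\<^sub>R (complex_of_real (\<rho> t (fst p) (snd p) * g (snd p)) * cis (- fst p)))"
      using linear_scale[OF bounded_linear.linear[OF T]] by simp
  qed
  also have "\<dots> = T (R t)"
    using integral_bounded_linear[OF T] cylinder_integral(1)[OF density[OF assms] cont_slice[OF assms]]
    by (simp add: R_eq[OF assms] set_integrable_def set_lebesgue_integral_def)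
  finally show ?thesis by (simp add: kuramoto_V_def T_def)
qed

text \<open>Testing the continuity equation against \<open>e\<^sup>-\<^sup>i\<^sup>k\<^sup>\<theta>\<close> couples the Fourier modes only to their
  neighbours, since the velocity field has only the modes \<open>0\<close> and \<open>\<plusminus>1\<close>.\<close>

lemma fourier_coeff_ode:
  assumes t: "0 \<le> t" and k: "0 < k"
  shows "((\<lambda>t. fourier_coeff (\<rho> t) k \<omega>) has_vector_derivative
      - (\<i> * of_nat k * of_real \<omega> * fourier_coeff (\<rho> t) k \<omega>)
      - complex_of_real (k * K / 2) * (cnj (R t) * fourier_coeff (\<rho> t) (k + 1) \<omega> - R t * fourier_coeff (\<rho> t) (k - 1) \<omega>))
      (at t within {0..})"
proof -
  define V where "V t \<theta> = K * Im (cis (- \<theta>) * cnj (R t))" for t \<theta>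
  define V' where "V' t \<theta> = - K * Re (cis (- \<theta>) * cnj (R t))" for t \<theta>
  have V': "(V t has_real_derivative V' t \<theta>) (at \<theta>)" for t \<theta>
    unfolding V_def[abs_def] V'_def
    by (auto intro!: derivative_eq_intros simp: algebra_simps)
  \<comment> \<open>The time derivative prescribed by the equation, with the velocity in closed
    form. In this form its continuity in time and angle, needed for the Leibniz rule, is
    visible.\<close>
  define D where "D t \<theta> = - (\<omega> * d_theta (\<rho> t) \<theta> \<omega> + (d_theta (\<rho> t) \<theta> \<omega> * V t \<theta> + \<rho> t \<theta> \<omega> * V' t \<theta>))" for t \<theta>
  have d\<rho>: "((\<lambda>x. \<rho> t x \<omega>) has_real_derivative d_theta (\<rho> t) \<theta> \<omega>) (at \<theta>)" if "0 \<le> t" for t \<theta>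
  proof -
    have "class_C_plane (Suc 0) (\<rho> t)"
      using class_C_plane_mono[OF class_C[OF that], of "Suc 0"] n_pos by simp
    then show ?thesis
      by (simp add: d_theta_def DERIV_deriv_iff_real_differentiable)
  qed
  have D: "((\<lambda>s. \<rho> s \<theta> \<omega>) has_real_derivative D t \<theta>) (at t within {0..})" if t: "0 \<le> t" for t \<theta>
  proof -
    have "((\<lambda>x. \<rho> t x \<omega> * V t x) has_real_derivative d_theta (\<rho> t) \<theta> \<omega> * V t \<theta> + \<rho> t \<theta> \<omega> * V' t \<theta>) (at \<theta>)"
      using DERIV_mult[OF d\<rho>[OF t, of \<theta>] V'[of t \<theta>]] by (simp add: mult_ac)
    moreover have "kuramoto_V g K (\<rho> t) = V t"
      using kuramoto_V_eq[OF t] by (auto simp: V_def)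
    ultimately have "deriv (\<lambda>\<theta>'. \<rho> t \<theta>' \<omega> * kuramoto_V g K (\<rho> t) \<theta>') \<theta> = d_theta (\<rho> t) \<theta> \<omega> * V t \<theta> + \<rho> t \<theta> \<omega> * V' t \<theta>"
      by (simp add: DERIV_imp_deriv)
    moreover have "deriv (\<lambda>\<theta>'. \<rho> t \<theta>' \<omega>) \<theta> = d_theta (\<rho> t) \<theta> \<omega>"
      by (simp add: d_theta_def)
    moreover obtain d where d: "((\<lambda>s. \<rho> s \<theta> \<omega>) has_real_derivative d) (at t within {0..})"
      "d + \<omega> * deriv (\<lambda>\<theta>'. \<rho> t \<theta>' \<omega>) \<theta> + deriv (\<lambda>\<theta>'. \<rho> t \<theta>' \<omega> * kuramoto_V g K (\<rho> t) \<theta>') \<theta> = 0"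
      using solution t unfolding kuramoto_solution_def by blast
    ultimately have "d = D t \<theta>" by (simp add: D_def)
    then show ?thesis using d(1) by simp
  qed
  have cont_comp: "continuous_on S (\<lambda>p. \<rho> (\<eta> p) (\<sigma> p) \<omega>)" "continuous_on S (\<lambda>p. d_theta (\<rho> (\<eta> p)) (\<sigma> p) \<omega>)"
    if "continuous_on S \<eta>" "continuous_on S \<sigma>" "\<And>p. p \<in> S \<Longrightarrow> 0 \<le> \<eta> p" for S :: "'b::topological_space set" and \<eta> \<sigma>
  proof -
    have *: "continuous_on S (\<lambda>p. (\<eta> p, \<sigma> p, \<omega>))" using that by (intro continuous_intros)
    show "continuous_on S (\<lambda>p. \<rho> (\<eta> p) (\<sigma> p) \<omega>)" "continuous_on S (\<lambda>p. d_theta (\<rho> (\<eta> p)) (\<sigma> p) \<omega>)"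
      using continuous_on_compose2[OF cont_\<rho> *] continuous_on_compose2[OF cont_d_theta *] that(3)
      by (auto simp: image_subset_iff)
  qed
  have cont_D: "continuous_on S (\<lambda>p. D (\<eta> p) (\<sigma> p))"
    if "continuous_on S \<eta>" "continuous_on S \<sigma>" "\<And>p. p \<in> S \<Longrightarrow> 0 \<le> \<eta> p" for S :: "'b::topological_space set" and \<eta> \<sigma>
  proof -
    have "continuous_on S (\<lambda>p. R (\<eta> p))"
      using that(3) by (intro continuous_on_compose2[OF cont_R that(1)]) auto
    then show ?thesis
      unfolding D_def V_def V'_def using that by (intro continuous_intros cont_comp)
  qed
  have "((\<lambda>t. integral (cbox 0 (2 * pi)) (\<lambda>\<theta>. complex_of_real (\<rho> t \<theta> \<omega>) * cis (- (real k * \<theta>)))) has_vector_derivative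
      integral (cbox 0 (2 * pi)) (\<lambda>\<theta>. complex_of_real (D t \<theta>) * cis (- (real k * \<theta>)))) (at t within {0..})"
  proof (rule leibniz_rule_vector_derivative)
    fix s \<theta> :: real
    assume "s \<in> {0..}"
    then have "((\<lambda>t. \<rho> t \<theta> \<omega>) has_real_derivative D s \<theta>) (at s within {0..})" by (simp add: D)
    then show "((\<lambda>t. complex_of_real (\<rho> t \<theta> \<omega>) * cis (- (real k * \<theta>))) has_vector_derivative
        complex_of_real (D s \<theta>) * cis (- (real k * \<theta>))) (at s within {0..})"
      by (intro has_vector_derivative_mult_left has_vector_derivative_of_real)
  next
    fix s :: real
    assume "s \<in> {0..}"
    then have "0 \<le> s" by simp
    from integral_slice(1)[OF continuous_on_fourier_integrand[OF cont_slice[OF this]],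
        THEN set_borel_integral_eq_integral(1)]
    show "(\<lambda>\<theta>. complex_of_real (\<rho> s \<theta> \<omega>) * cis (- (real k * \<theta>))) integrable_on cbox 0 (2 * pi)" by simp
  next
    show "continuous_on ({0..} \<times> cbox 0 (2 * pi)) (\<lambda>(t, \<theta>). complex_of_real (D t \<theta>) * cis (- (real k * \<theta>)))"
      unfolding case_prod_unfold by (intro continuous_intros cont_D) auto
  qed (use t in auto)
  moreover have "integral (cbox 0 (2 * pi)) (\<lambda>\<theta>. complex_of_real (D t \<theta>) * cis (- (real k * \<theta>))) =
      - (\<i> * of_nat k * of_real \<omega> * fourier_coeff (\<rho> t) k \<omega>)
      - complex_of_real (k * K / 2) * (cnj (R t) * fourier_coeff (\<rho> t) (k + 1) \<omega> - R t * fourier_coeff (\<rho> t) (k - 1) \<omega>)"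
  proof -
    \<comment> \<open>\<open>Q\<close> is the flux, and \<open>D\<close> is minus its derivative.
      Integration by parts moves the derivative to the exponential; the boundary terms cancel
      because the density, the velocity and the exponential are all periodic.\<close>
    define Q where "Q \<theta> = \<rho> t \<theta> \<omega> * (\<omega> + V t \<theta>)" for \<theta>
    define e where "e j \<theta> = complex_of_real (\<rho> t \<theta> \<omega>) * cis (- (real j * \<theta>))" for j \<theta>
    have dQ: "(Q has_real_derivative - D t \<theta>) (at \<theta> within {0..2 * pi})" for \<theta>
    proof -
      have "((\<lambda>\<theta>. \<omega> + V t \<theta>) has_real_derivative V' t \<theta>) (at \<theta>)"
        using V'[of t \<theta>] by (auto intro!: derivative_eq_intros)
      from DERIV_mult[OF d\<rho>[OF t] this] have "(Q has_real_derivative - D t \<theta>) (at \<theta>)"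
        by (simp add: Q_def[abs_def] D_def algebra_simps)
      then show ?thesis by (rule has_field_derivative_at_within)
    qed
    have e_int: "(e j has_integral fourier_coeff (\<rho> t) j \<omega>) {0..2 * pi}" for j
      unfolding fourier_coeff_def e_def
      using integral_slice(1)[OF continuous_on_fourier_integrand[OF cont_slice[OF t]]]
      by (intro integrable_integral set_borel_integral_eq_integral(1))
    have dQe: "((\<lambda>\<theta>. complex_of_real (Q \<theta>) * cis (- real k * \<theta> + 0)) has_vector_derivative
        complex_of_real (Q \<theta>) * (\<i> * of_real (- real k) * cis (- real k * \<theta> + 0)) +
        complex_of_real (- D t \<theta>) * cis (- real k * \<theta> + 0)) (at \<theta> within {0..2 * pi})" for \<theta>
      by (intro has_vector_derivative_mult has_vector_derivative_cis_linear has_vector_derivative_of_real dQ)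
    have bdry: "Q (2 * pi) = Q 0" "cis (- real k * (2 * pi) + 0) = 1"
      using periodic[OF t, of 0] cis_multiple_2pi[of "- of_nat k"]
      by (simp_all add: Q_def V_def mult_ac)
    have "((\<lambda>\<theta>. complex_of_real (Q \<theta>) * (\<i> * of_real (- real k) * cis (- real k * \<theta> + 0)) +
        complex_of_real (- D t \<theta>) * cis (- real k * \<theta> + 0)) has_integral
        (complex_of_real (Q (2 * pi)) * cis (- real k * (2 * pi) + 0) - complex_of_real (Q 0) * cis (- real k * 0 + 0))) {0..2 * pi}"
      by (rule fundamental_theorem_of_calculus[OF _ dQe]) simp
    then have total: "((\<lambda>\<theta>. complex_of_real (Q \<theta>) * (\<i> * of_real (- real k) * cis (- real k * \<theta> + 0)) +
        complex_of_real (- D t \<theta>) * cis (- real k * \<theta> + 0)) has_integral 0) {0..2 * pi}"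
      unfolding bdry by simp
    \<comment> \<open>The imaginary part in \<open>V\<close> is a difference of conjugates over
      \<open>2 * \<i>\<close>. Its two exponentials raise and lower the index by one, and
      \<open>- \<i> * k * K / (2 * \<i>)\<close> is the coefficient \<open>- k * K / 2\<close>. The
      natural number \<open>k - 1\<close> is a true difference since \<open>0 < k\<close>.\<close>
    have Q_eq: "complex_of_real (Q \<theta>) * (\<i> * of_real (- real k) * cis (- real k * \<theta> + 0)) =
        - (\<i> * of_nat k * of_real \<omega>) * e k \<theta> - complex_of_real (k * K / 2) * (cnj (R t) * e (k + 1) \<theta> - R t * e (k - 1) \<theta>)" for \<theta>
    proof -
      have V: "complex_of_real (V t \<theta>) = complex_of_real K * ((cis (- \<theta>) * cnj (R t) - cis \<theta> * R t) / (2 * \<i>))"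
      proof -
        have "z - cnj z = 2 * \<i> * complex_of_real (Im z)" for z
          by (simp add: complex_eq_iff)
        from this[of "cis (- \<theta>) * cnj (R t)"]
        have "cis (- \<theta>) * cnj (R t) - cis \<theta> * R t = 2 * \<i> * complex_of_real (Im (cis (- \<theta>) * cnj (R t)))"
          by (simp add: cis_cnj)
        then show ?thesis by (simp add: V_def)
      qed
      have k1: "real (k - 1) = real k - 1" using k by (simp add: of_nat_diff)
      have c: "cis (- (real (k + 1) * \<theta>)) = cis (- (real k * \<theta>)) * cis (- \<theta>)"
        "cis (- (real (k - 1) * \<theta>)) = cis (- (real k * \<theta>)) * cis \<theta>"
        unfolding cis_mult k1 by (simp_all add: algebra_simps)
      show ?thesis
        unfolding e_def c Q_def of_real_mult of_real_add V
        by (simp add: field_simps)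
    qed
    \<comment> \<open>Subtracting the integrand of \<open>total\<close>, whose integral is 0, leaves
      \<open>D t \<theta>\<close> times the exponential.\<close>
    have "((\<lambda>\<theta>. (- (\<i> * of_nat k * of_real \<omega>) * e k \<theta> - complex_of_real (k * K / 2) * (cnj (R t) * e (k + 1) \<theta> - R t * e (k - 1) \<theta>))
       - (complex_of_real (Q \<theta>) * (\<i> * of_real (- real k) * cis (- real k * \<theta> + 0)) +
        complex_of_real (- D t \<theta>) * cis (- real k * \<theta> + 0)))
       has_integral (- (\<i> * of_nat k * of_real \<omega>) * fourier_coeff (\<rho> t) k \<omega>
      - complex_of_real (k * K / 2) * (cnj (R t) * fourier_coeff (\<rho> t) (k + 1) \<omega> - R t * fourier_coeff (\<rho> t) (k - 1) \<omega>) - 0)) {0..2 * pi}"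
      by (intro has_integral_diff has_integral_mult_right e_int total)
    then show ?thesis
      unfolding Q_eq by (intro integral_unique) simp
  qed
  ultimately show ?thesis by (simp add: fourier_coeff_def)
qed

text \<open>In the moving frame the transport term cancels and only the interaction remains. This is
  carried out at fixed \<omega>, before averaging with \<open>g\<close>, because
  \<open>\<omega> * g \<omega>\<close> need not be integrable.\<close>

lemma moment_duhamel:
  assumes k: "0 < k" and t: "0 \<le> t"
  shows "moment k t \<tau> = moment k 0 \<tau> - complex_of_real (k * K / 2) *
    integral {0..t} (\<lambda>s. cnj (R s) * moment (k + 1) s (\<tau> + s) - R s * moment (k - 1) s (\<tau> - s))"
proof -
  define \<alpha> where "\<alpha> j s \<omega> = fourier_coeff (\<rho> s) j \<omega>" for j s \<omega>
  define h where "h s \<omega> = cis (real k * s * \<omega> - \<tau> * \<omega>) *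
     (cnj (R s) * \<alpha> (k + 1) s \<omega> - R s * \<alpha> (k - 1) s \<omega>)" for s \<omega>
  have k1: "real (k - 1) = real k - 1" using k by (simp add: of_nat_diff)
  have R_le: "norm (R s) \<le> 1" if "0 \<le> s" for s
    unfolding R_def by (rule norm_moment[OF that])
  have h_moment: "(LBINT \<omega>. complex_of_real (g \<omega>) * h s \<omega>) =
      cnj (R s) * moment (k + 1) s (\<tau> + s) - R s * moment (k - 1) s (\<tau> - s)" if s: "0 \<le> s" for s
  proof -
    have "(LBINT \<omega>. complex_of_real (g \<omega>) * h s \<omega>) =
       (LBINT \<omega>. cnj (R s) * (complex_of_real (g \<omega>) * (fourier_coeff (\<rho> s) (k + 1) \<omega> * cis (real (k + 1) * s * \<omega> - (\<tau> + s) * \<omega>)))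
         - R s * (complex_of_real (g \<omega>) * (fourier_coeff (\<rho> s) (k - 1) \<omega> * cis (real (k - 1) * s * \<omega> - (\<tau> - s) * \<omega>))))"
    proof (intro Bochner_Integration.integral_cong refl)
      fix \<omega>
      \<comment> \<open>A change of the index by one changes the phase by
        \<open>s * \<omega>\<close>; the shift of \<tau> by \<open>s\<close> compensates for it.
        This is the origin of the arguments \<open>\<tau> + s\<close> and
        \<open>\<tau> - s\<close>.\<close>
      have "real (k + 1) * s * \<omega> - (\<tau> + s) * \<omega> = real k * s * \<omega> - \<tau> * \<omega>"
        "real (k - 1) * s * \<omega> - (\<tau> - s) * \<omega> = real k * s * \<omega> - \<tau> * \<omega>"
        unfolding k1 by (simp_all add: algebra_simps)
      then show "complex_of_real (g \<omega>) * h s \<omega> =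
         cnj (R s) * (complex_of_real (g \<omega>) * (fourier_coeff (\<rho> s) (k + 1) \<omega> * cis (real (k + 1) * s * \<omega> - (\<tau> + s) * \<omega>)))
         - R s * (complex_of_real (g \<omega>) * (fourier_coeff (\<rho> s) (k - 1) \<omega> * cis (real (k - 1) * s * \<omega> - (\<tau> - s) * \<omega>)))"
        unfolding h_def \<alpha>_def by (simp only:) (simp add: algebra_simps)
    qed
    also have "\<dots> = cnj (R s) * moment (k + 1) s (\<tau> + s) - R s * moment (k - 1) s (\<tau> - s)"
      unfolding moment_def using integrable_moment[OF s]
      by (subst Bochner_Integration.integral_diff) auto
    finally show ?thesis .
  qed
  have cont_moments: "continuous_on {0..t} (\<lambda>s. cnj (R s) * moment (k + 1) s (\<tau> + s) - R s * moment (k - 1) s (\<tau> - s))"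
  proof -
    have "continuous_on {0..t} R" using cont_R by (rule continuous_on_subset) auto
    then show ?thesis by (intro continuous_intros moment_comp_cont) auto
  qed
  have cont_h: "continuous_on ({0..t} \<times> UNIV) (\<lambda>(s, \<omega>). h s \<omega>)"
  proof -
    have "continuous_on ({0..t} \<times> UNIV) (\<lambda>(s, \<omega>). \<alpha> j s \<omega>)" for j
      unfolding \<alpha>_def using cont_fourier_coeff by (rule continuous_on_subset) auto
    moreover have "continuous_on ({0..t} \<times> UNIV) (\<lambda>p :: real \<times> real. R (fst p))"
      by (intro continuous_on_compose2[OF cont_R] continuous_intros) auto
    ultimately show ?thesis
      unfolding h_def case_prod_unfold by (intro continuous_intros)
  qed
  have phase: "\<alpha> k t \<omega> * cis (real k * t * \<omega> - \<tau> * \<omega>) - \<alpha> k 0 \<omega> * cis (- (\<tau> * \<omega>)) =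
      - complex_of_real (k * K / 2) * integral {0..t} (\<lambda>s. h s \<omega>)" for \<omega>
  proof -
    have "((\<lambda>s. - complex_of_real (k * K / 2) * h s \<omega>) has_integral
       (\<alpha> k t \<omega> * cis (real k * \<omega> * t + - (\<tau> * \<omega>)) - \<alpha> k 0 \<omega> * cis (real k * \<omega> * 0 + - (\<tau> * \<omega>)))) {0..t}"
    proof (rule fundamental_theorem_of_calculus[OF t])
      fix s
      assume "s \<in> {0..t}"
      then have s: "0 \<le> s" by simp
      have "((\<lambda>s. \<alpha> k s \<omega> * cis (real k * \<omega> * s + - (\<tau> * \<omega>))) has_vector_derivative
         \<alpha> k s \<omega> * (\<i> * of_real (real k * \<omega>) * cis (real k * \<omega> * s + - (\<tau> * \<omega>))) +
         (- (\<i> * of_nat k * of_real \<omega> * \<alpha> k s \<omega>)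
      - complex_of_real (k * K / 2) * (cnj (R s) * \<alpha> (k + 1) s \<omega> - R s * \<alpha> (k - 1) s \<omega>)) * cis (real k * \<omega> * s + - (\<tau> * \<omega>)))
        (at s within {0..t})"
        unfolding \<alpha>_def
        by (intro has_vector_derivative_mult has_vector_derivative_cis_linear
            has_vector_derivative_within_subset[OF fourier_coeff_ode[OF s k]]) auto
      \<comment> \<open>The derivative of the phase cancels the transport term of the mode
        equation.\<close>
      also have "\<alpha> k s \<omega> * (\<i> * of_real (real k * \<omega>) * cis (real k * \<omega> * s + - (\<tau> * \<omega>))) +
         (- (\<i> * of_nat k * of_real \<omega> * \<alpha> k s \<omega>)
      - complex_of_real (k * K / 2) * (cnj (R s) * \<alpha> (k + 1) s \<omega> - R s * \<alpha> (k - 1) s \<omega>)) * cis (real k * \<omega> * s + - (\<tau> * \<omega>))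
        = - complex_of_real (k * K / 2) * h s \<omega>"
      proof -
        have "real k * s * \<omega> - \<tau> * \<omega> = real k * \<omega> * s + - (\<tau> * \<omega>)" by simp
        then show ?thesis unfolding h_def by (simp only:) (simp add: algebra_simps)
      qed
      finally show "((\<lambda>s. \<alpha> k s \<omega> * cis (real k * \<omega> * s + - (\<tau> * \<omega>))) has_vector_derivative
          - complex_of_real (k * K / 2) * h s \<omega>) (at s within {0..t})" .
    qed
    from integral_unique[OF this] show ?thesis by (simp add: mult_ac)
  qed
  have "moment k t \<tau> - moment k 0 \<tau> =
     (LBINT \<omega>. complex_of_real (g \<omega>) * (\<alpha> k t \<omega> * cis (real k * t * \<omega> - \<tau> * \<omega>)) -
        complex_of_real (g \<omega>) * (\<alpha> k 0 \<omega> * cis (real k * 0 * \<omega> - \<tau> * \<omega>)))"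
    unfolding moment_def \<alpha>_def
    by (rule Bochner_Integration.integral_diff[symmetric]; rule integrable_moment) (use t in auto)
  also have "\<dots> = (LBINT \<omega>. - complex_of_real (k * K / 2) * (complex_of_real (g \<omega>) * integral {0..t} (\<lambda>s. h s \<omega>)))"
  proof (intro Bochner_Integration.integral_cong refl)
    fix \<omega>
    show "complex_of_real (g \<omega>) * (\<alpha> k t \<omega> * cis (real k * t * \<omega> - \<tau> * \<omega>)) -
        complex_of_real (g \<omega>) * (\<alpha> k 0 \<omega> * cis (real k * 0 * \<omega> - \<tau> * \<omega>)) =
       - complex_of_real (k * K / 2) * (complex_of_real (g \<omega>) * integral {0..t} (\<lambda>s. h s \<omega>))"
      using arg_cong[OF phase[of \<omega>], of "\<lambda>z. complex_of_real (g \<omega>) * z"]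
      by (simp add: right_diff_distrib mult.left_commute)
  qed
  also have "\<dots> = - complex_of_real (k * K / 2) * (LBINT \<omega>. complex_of_real (g \<omega>) * integral {0..t} (\<lambda>s. h s \<omega>))"
    by (rule integral_mult_right_zero)
  also have "(LBINT \<omega>. complex_of_real (g \<omega>) * integral {0..t} (\<lambda>s. h s \<omega>)) =
      integral {0..t} (\<lambda>s. LBINT \<omega>. complex_of_real (g \<omega>) * h s \<omega>)"
  proof (rule LBINT_integral_swap[OF cont_h _ g_int t])
    show "norm (h s \<omega>) \<le> 2" if "s \<in> {0..t}" for s \<omega>
    proof -
      have s: "0 \<le> s" using that by simp
      have *: "norm (R s) * norm (\<alpha> j s \<omega>) \<le> 1 * 1" for j
        unfolding \<alpha>_def by (intro mult_mono R_le norm_fourier_coeff s) auto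
      have "norm (h s \<omega>) \<le> norm (R s) * norm (\<alpha> (k + 1) s \<omega>) + norm (R s) * norm (\<alpha> (k - 1) s \<omega>)"
        unfolding h_def norm_mult
        by (simp, rule norm_triangle_ineq4[THEN order_trans]) (simp add: norm_mult)
      then show ?thesis using *[of "k + 1"] *[of "k - 1"] by linarith
    qed
    show "continuous_on {0..t} (\<lambda>s. LBINT \<omega>. complex_of_real (g \<omega>) * h s \<omega>)"
      using cont_moments by (rule continuous_on_eq) (simp add: h_moment)
  qed
  also have "\<dots> = integral {0..t} (\<lambda>s. cnj (R s) * moment (k + 1) s (\<tau> + s) - R s * moment (k - 1) s (\<tau> - s))"
    by (intro Henstock_Kurzweil_Integration.integral_cong h_moment) simp
  finally show ?thesis by (simp add: algebra_simps)
qed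

subsection \<open>Decay of the order parameter\<close>

text \<open>The second mode is taken at \<open>t + s\<close>, beyond \<open>t\<close>, and so
  carries the whole weight in \<open>t\<close>; its linear growth in \<open>s\<close> costs one
  power of the decay of \<open>R s\<close>, and \<open>3 \<le> n\<close> leaves an integrable
  square. For the mode 0 at \<open>t - s\<close> the weight is shared with
  \<open>R s\<close>.\<close>

lemma R_estimate:
  assumes n: "3 \<le> n" and K: "0 \<le> K" and C: "0 \<le> C" and N: "0 \<le> N"
    and q: "2 ^ (n + 1) * K * N \<le> 1 / 4"
    and init: "\<And>k \<tau>. (1 + \<bar>\<tau>\<bar>) ^ n * norm (moment k 0 \<tau>) \<le> C"
    and t: "0 \<le> t" and R_le: "\<And>s. s \<in> {0..t} \<Longrightarrow> norm (R s) * (1 + s) ^ n \<le> N"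
  shows "norm (R t) * (1 + t) ^ n \<le> C + K * N * (8 * (C + 1) + 2 ^ n * C)"
proof -
  define q where "q = 2 ^ (n + 1) * K * N"
  have q0: "0 \<le> q" and q4: "q \<le> 1 / 4" using K N q by (auto simp: q_def)
  have n2: "2 \<le> n" using n by simp
  have contR: "continuous_on {0..t} R" using cont_R by (rule continuous_on_subset) auto
  have moment_le: "(1 + \<bar>\<tau>\<bar>) ^ n * norm (moment k s \<tau>) \<le> (C + q * s / 2) * 4 ^ k"
    if s: "s \<in> {0..t}" for k s \<tau>
  proof (rule hierarchy_bound[where f = moment and R = R and T = t, OF n2 K C N q_def q4 _ contR _ _ _ init R_le s])
    show "continuous_on ({0..t} \<times> UNIV) (\<lambda>(s, \<tau>). moment k s \<tau>)" for k
      using cont_moment by (rule continuous_on_subset) auto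
  qed (rule norm_moment moment_0 moment_duhamel; simp)+
  define h where "h s = cnj (R s) * moment 2 s (t + s) - R s * moment 0 s (t - s)" for s
  \<comment> \<open>\<open>c\<close> comes from the mode 0 and \<open>d\<close> from the second
    mode, with the 16 from \<open>4 ^ 2\<close> in \<open>hierarchy_bound\<close>.\<close>
  define c where "c = 2 ^ n * N * C"
  define d where "d = 16 * N * (C + 1)"
  have c0: "0 \<le> c" and d0: "0 \<le> d" using N C by (auto simp: c_def d_def)
  have bound: "norm (complex_of_real ((1 + t) ^ n) * h s) \<le> (c + d) / (1 + s)\<^sup>2 + c / (1 + t - s)\<^sup>2"
    if s: "s \<in> {0..t}" for s
  proof -
    have s0: "0 \<le> s" "s \<le> t" using s by auto
    have sq: "x \<le> B / a\<^sup>2" if "x * a ^ n \<le> B" "1 \<le> a" "0 \<le> x" for x B a :: real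
    proof -
      have "x * a\<^sup>2 \<le> x * a ^ n" using that n by (intro mult_left_mono power_increasing) auto
      then show ?thesis using that by (simp add: pos_le_divide_eq)
    qed
    have "norm (R s) * (1 + s) ^ n \<le> N" by (rule R_le[OF s])
    then have Rs: "norm (R s) \<le> N / (1 + s)\<^sup>2" using s0 by (intro sq) auto
    have m0n: "norm (moment 0 s (t - s)) * (1 + t - s) ^ n \<le> C"
      using init[of "t - s" 0] s0 moment_0[OF s0(1), of "t - s"] by (simp add: mult.commute add_diff_eq)
    then have m0: "norm (moment 0 s (t - s)) \<le> C / (1 + t - s)\<^sup>2" using s0 by (intro sq) auto
    have "norm (R s) * ((1 + t) ^ n * norm (moment 2 s (t + s))) \<le> d / (1 + s)\<^sup>2"
    proof -
      have "(1 + t) ^ n * norm (moment 2 s (t + s)) \<le> (1 + \<bar>t + s\<bar>) ^ n * norm (moment 2 s (t + s))"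
        using s0 by (intro mult_right_mono power_mono) auto
      also have "\<dots> \<le> (C + q * s / 2) * 4 ^ 2" by (rule moment_le[OF s])
      \<comment> \<open>The bound on \<open>q\<close> makes the growth in \<open>s\<close>
        independent of \<open>K\<close> and \<open>N\<close>, so that the final estimate is linear
        in \<open>K * N\<close>.\<close>
      also have "\<dots> \<le> 16 * (C + 1) * (1 + s)"
      proof -
        have "q * s \<le> 1 * s" using q4 s0 by (intro mult_right_mono) auto
        moreover have "0 \<le> C * s" using C s0 by simp
        ultimately show ?thesis using s0 by (simp add: algebra_simps)
      qed
      finally have "norm (R s) * ((1 + t) ^ n * norm (moment 2 s (t + s))) \<le> norm (R s) * (16 * (C + 1) * (1 + s))"
        by (rule mult_left_mono) simp
      also have "\<dots> = 16 * (C + 1) * (norm (R s) * (1 + s))" by simp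
      also have "norm (R s) * (1 + s) \<le> N / (1 + s)\<^sup>2"
      proof -
        have "norm (R s) * (1 + s) * (1 + s)\<^sup>2 = norm (R s) * (1 + s) ^ 3"
          by (simp add: power2_eq_square power3_eq_cube)
        also have "\<dots> \<le> norm (R s) * (1 + s) ^ n"
          using s0 n by (intro mult_left_mono power_increasing) auto
        also have "\<dots> \<le> N" by (rule R_le[OF s])
        finally show ?thesis using s0 by (simp add: pos_le_divide_eq)
      qed
      finally show ?thesis using C by (simp add: d_def mult_left_mono mult_ac)
    qed
    moreover have "norm (R s) * ((1 + t) ^ n * norm (moment 0 s (t - s))) \<le> c / (1 + s)\<^sup>2 + c / (1 + t - s)\<^sup>2"
    proof -
      \<comment> \<open>The larger of \<open>s\<close> and \<open>t - s\<close> is at least half of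
        \<open>t\<close>: the factor belonging to it takes over the weight, and the other is still
        integrable by its quadratic decay.\<close>
      have "(1 + t) ^ n \<le> (2 * max (1 + t - s) (1 + s)) ^ n"
        using s0 by (intro power_mono) (auto simp: max_def)
      also have "\<dots> = 2 ^ n * max (1 + t - s) (1 + s) ^ n" by (simp add: power_mult_distrib)
      also have "\<dots> \<le> 2 ^ n * ((1 + t - s) ^ n + (1 + s) ^ n)"
        using s0 by (intro mult_left_mono) (auto simp: max_def)
      finally have "norm (R s) * ((1 + t) ^ n * norm (moment 0 s (t - s))) \<le>
          norm (R s) * (2 ^ n * ((1 + t - s) ^ n + (1 + s) ^ n) * norm (moment 0 s (t - s)))"
        by (intro mult_left_mono mult_right_mono) auto
      also have "\<dots> = 2 ^ n * (norm (R s) * (norm (moment 0 s (t - s)) * (1 + t - s) ^ n) +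
          (norm (R s) * (1 + s) ^ n) * norm (moment 0 s (t - s)))"
        by (simp add: algebra_simps)
      also have "\<dots> \<le> 2 ^ n * (N / (1 + s)\<^sup>2 * C + N * (C / (1 + t - s)\<^sup>2))"
        using s0 N by (intro mult_left_mono add_mono mult_mono Rs m0n R_le[OF s] m0) auto
      finally show ?thesis by (simp add: c_def algebra_simps)
    qed
    moreover have "norm (complex_of_real ((1 + t) ^ n) * h s) \<le>
       norm (R s) * ((1 + t) ^ n * norm (moment 2 s (t + s))) + norm (R s) * ((1 + t) ^ n * norm (moment 0 s (t - s)))"
    proof -
      have "norm (complex_of_real ((1 + t) ^ n) * h s) = (1 + t) ^ n * norm (h s)"
        using t by (simp add: norm_mult norm_power del: of_real_add of_real_power)
      also have "\<dots> \<le> (1 + t) ^ n * (norm (R s) * norm (moment 2 s (t + s)) + norm (R s) * norm (moment 0 s (t - s)))"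
        using t unfolding h_def
        by (intro mult_left_mono norm_triangle_ineq4[THEN order_trans]) (auto simp: norm_mult)
      finally show ?thesis by (simp add: algebra_simps)
    qed
    ultimately show ?thesis by (simp add: add_divide_distrib)
  qed
  \<comment> \<open>An antiderivative of the bound. Each of the two inverse squares has integral at
    most 1 over \<open>{0..t}\<close>, whence \<open>(c + d) + c\<close>.\<close>
  define F where "F s = - (c + d) / (1 + s) + c / (1 + t - s)" for s
  have F: "((\<lambda>s. (c + d) / (1 + s)\<^sup>2 + c / (1 + t - s)\<^sup>2) has_integral (F t - F 0)) {0..t}"
  proof (rule fundamental_theorem_of_calculus[OF t])
    fix s
    assume "s \<in> {0..t}"
    then have nz: "1 + s \<noteq> 0" "1 + t - s \<noteq> 0" by auto
    have "(F has_real_derivative (c + d) / (1 + s)\<^sup>2 + c / (1 + t - s)\<^sup>2) (at s within {0..t})"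
      unfolding F_def[abs_def] using nz
      by (auto intro!: derivative_eq_intros simp: power2_eq_square)
    then show "(F has_vector_derivative (c + d) / (1 + s)\<^sup>2 + c / (1 + t - s)\<^sup>2) (at s within {0..t})"
      by (simp add: has_real_derivative_iff_has_vector_derivative)
  qed
  have cont_h: "continuous_on {0..t} h"
    unfolding h_def[abs_def] by (intro continuous_intros contR moment_comp_cont) auto
  have "norm (integral {0..t} (\<lambda>s. complex_of_real ((1 + t) ^ n) * h s)) \<le>
      integral {0..t} (\<lambda>s. (c + d) / (1 + s)\<^sup>2 + c / (1 + t - s)\<^sup>2)"
    by (rule Henstock_Kurzweil_Integration.integral_norm_bound_integral[OF _ _ bound])
       (use F in \<open>auto intro!: integrable_continuous_real continuous_intros cont_h\<close>)
  also have "\<dots> = F t - F 0" by (rule integral_unique[OF F])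
  also have "\<dots> \<le> 2 * c + d"
  proof -
    have "F t - F 0 = 2 * c + d - (2 * c + d) / (1 + t)"
      unfolding F_def by (simp add: diff_divide_distrib add_divide_distrib)
    then show ?thesis using c0 d0 t by simp
  qed
  finally have I: "(1 + t) ^ n * norm (integral {0..t} h) \<le> 2 * c + d"
    using t by (simp add: norm_mult norm_power del: of_real_add of_real_power)
  have "R t = moment 1 0 t - complex_of_real (K / 2) * integral {0..t} h"
    unfolding R_def using moment_duhamel[of 1 t t] t by (simp add: h_def[abs_def] R_def numeral_2_eq_2)
  then have "norm (R t) \<le> norm (moment 1 0 t) + K / 2 * norm (integral {0..t} h)"
    using norm_triangle_ineq4[of "moment 1 0 t" "complex_of_real (K / 2) * integral {0..t} h"] K
    by (simp add: norm_mult)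
  then have "norm (R t) * (1 + t) ^ n \<le> (norm (moment 1 0 t) + K / 2 * norm (integral {0..t} h)) * (1 + t) ^ n"
    using t by (intro mult_right_mono) auto
  also have "\<dots> = (1 + t) ^ n * norm (moment 1 0 t) + K / 2 * ((1 + t) ^ n * norm (integral {0..t} h))"
    by (simp add: algebra_simps)
  also have "\<dots> \<le> C + K / 2 * (2 * c + d)"
    using init[of t 1] t K by (intro add_mono mult_left_mono I) auto
  also have "\<dots> = C + K * N * (8 * (C + 1) + 2 ^ n * C)"
    by (simp add: c_def d_def algebra_simps)
  finally show ?thesis .
qed

text \<open>Continuity argument: up to the first time at which \<open>2 * C\<close> is reached,
  \<open>R_estimate\<close> applies with \<open>N = 2 * C\<close>, and for small \<open>K\<close> it
  gives a value strictly below \<open>2 * C\<close> at that very time.\<close>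

lemma R_decay:
  assumes n: "3 \<le> n" and K: "0 \<le> K" and C: "0 < C"
    and K_small: "K * (16 * (C + 1) + 2 ^ (n + 4) * C) < 1"
    and init: "\<And>k \<tau>. (1 + \<bar>\<tau>\<bar>) ^ n * norm (moment k 0 \<tau>) \<le> C"
    and t: "0 \<le> t"
  shows "norm (R t) * (1 + t) ^ n \<le> 2 * C"
proof (rule ccontr)
  define \<phi> where "\<phi> s = norm (R s) * (1 + s) ^ n" for s
  assume "\<not> ?thesis"
  then have gt: "2 * C < \<phi> t" by (simp add: \<phi>_def)
  have cont: "continuous_on {0..} \<phi>"
    unfolding \<phi>_def[abs_def] by (intro continuous_intros cont_R)
  define S where "S = {s \<in> {0..t}. 2 * C \<le> \<phi> s}"
  have "closed S"
    unfolding S_def by (intro continuous_on_closed_Collect_le continuous_intros continuous_on_subset[OF cont]) auto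
  moreover have "bounded S" by (rule bounded_subset[of "{0..t}"]) (auto simp: S_def)
  ultimately have "compact S" by (simp add: compact_eq_bounded_closed)
  moreover have "t \<in> S" using gt t by (simp add: S_def)
  ultimately obtain a where a: "a \<in> S" "\<And>s. s \<in> S \<Longrightarrow> a \<le> s"
    using compact_attains_inf[of S] by blast
  have a0: "0 \<le> a" and a_ge: "2 * C \<le> \<phi> a" using a by (auto simp: S_def)
  have "\<phi> 0 \<le> 2 * C" using init[of 0 1] C by (simp add: \<phi>_def R_def)
  \<comment> \<open>The intermediate value theorem shows that the least point of \<open>S\<close>
    has exactly the value \<open>2 * C\<close>, so the bound holds on the closed interval up to
    \<open>a\<close>, as \<open>R_estimate\<close> requires.\<close>
  then obtain b where b: "0 \<le> b" "b \<le> a" "\<phi> b = 2 * C"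
    using IVT'[of \<phi> 0 "2 * C" a] a_ge a0 continuous_on_subset[OF cont, of "{0..a}"] by auto
  then have "b \<in> S" using a by (auto simp: S_def)
  then have a_eq: "\<phi> a = 2 * C" using a(2)[of b] b by simp
  have le: "norm (R s) * (1 + s) ^ n \<le> 2 * C" if "s \<in> {0..a}" for s
  proof (rule ccontr)
    assume "\<not> ?thesis"
    then have *: "2 * C < \<phi> s" by (simp add: \<phi>_def)
    then have "s \<in> S" using that a by (auto simp: S_def)
    then have "s = a" using a(2) that by force
    then show False using * a_eq by simp
  qed
  have KC: "0 \<le> K * C" "0 \<le> 2 ^ n * (K * C)" using K C by auto
  \<comment> \<open>This is \<open>K * (2 ^ (n + 4) * C) \<le> 1\<close>, the origin of the exponent
    \<open>n + 4\<close> in \<open>K_small\<close>. The summand \<open>16 * (C + 1)\<close> there is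
    for the strict improvement below.\<close>
  have "2 ^ (n + 1) * K * (2 * C) \<le> 1 / 4"
    using K_small K KC by (simp add: power_add algebra_simps)
  then have "\<phi> a \<le> C + K * (2 * C) * (8 * (C + 1) + 2 ^ n * C)"
    unfolding \<phi>_def using C by (intro R_estimate[OF n K _ _ _ init a0 le]) auto
  also have "\<dots> = C + C * (K * (16 * (C + 1) + 2 * 2 ^ n * C))"
    by (simp add: algebra_simps)
  also have "\<dots> < C + C * 1"
  proof -
    have "K * (16 * (C + 1) + 2 * 2 ^ n * C) \<le> K * (16 * (C + 1) + 2 ^ (n + 4) * C)"
      using K C by (intro mult_left_mono add_left_mono mult_right_mono) (auto simp: power_add)
    then have "K * (16 * (C + 1) + 2 * 2 ^ n * C) < 1" using K_small by linarith
    then show ?thesis using C by simp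
  qed
  finally show False using a_eq by simp
qed

end

section \<open>Choice of the coupling threshold and conclusion\<close>

theorem proposition3p2:
  fixes g :: "real \<Rightarrow> real" and n :: nat and r0 :: "real \<Rightarrow> real \<Rightarrow> real"
  assumes "n \<ge> 4"
    and "probability_density g"
    and "class_C_line n g"
    and "H_norm_sq_line n g < \<infinity>"
    and "set_integrable lborel {0..} (fourier g)"
    and "set_integrable lborel {0..} (\<lambda>t. t ^ n * norm (fourier g t))"
    and "class_C_cylinder n r0"
    and "\<And>\<theta> \<omega>. 1 / (2 * pi) + r0 \<theta> \<omega> \<ge> 0"
    and "\<And>\<omega>. (LINT \<theta>:{0..2 * pi}|lborel. r0 \<theta> \<omega>) = 0"
    and "H_norm_sq_cylinder n (\<lambda>\<theta> \<omega>. r0 \<theta> \<omega> * g \<omega>) < \<infinity>"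
  shows "\<exists>K\<^sub>r>0. \<forall>K. 0 \<le> K \<and> K < K\<^sub>r \<longrightarrow>
           (\<forall>\<rho>. kuramoto_solution n g K \<rho> \<and> (\<forall>\<theta> \<omega>. \<rho> 0 \<theta> \<omega> = 1 / (2 * pi) + r0 \<theta> \<omega>) \<longrightarrow>
              (\<lambda>t. order_parameter g (\<lambda>\<theta> \<omega>. \<rho> t \<theta> \<omega> - 1 / (2 * pi)))
                \<in> O[at_top](\<lambda>t. inverse (complex_of_real t ^ n)))"
proof -
  have r0: "class_C_plane n r0" using assms(7) by (simp add: class_C_cylinder_def)
  obtain C\<^sub>g where C\<^sub>g: "\<And>\<tau>. (1 + \<bar>\<tau>\<bar>) ^ n * norm (LBINT \<omega>. complex_of_real (g \<omega>) * cis (- (\<tau> * \<omega>))) \<le> C\<^sub>g"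
    using fourier_decay_H_norm[OF assms(3,4)] by blast
  have "class_C_plane n (\<lambda>\<theta> \<omega>. r0 \<theta> \<omega> * g \<omega>)"
    by (intro class_C_plane_mult r0 class_C_line_imp_plane assms(3))
  then obtain C\<^sub>r where C\<^sub>r: "\<And>k \<tau>. (1 + \<bar>\<tau>\<bar>) ^ n *
      norm (LBINT \<omega>. fourier_coeff (\<lambda>\<theta> \<omega>. r0 \<theta> \<omega> * g \<omega>) k \<omega> * cis (- (\<tau> * \<omega>))) \<le> C\<^sub>r"
    using fourier_coeff_decay[OF _ assms(10)] by blast
  \<comment> \<open>\<open>C\<^sub>g\<close> bounds the mode 0 and \<open>C\<^sub>r\<close> the
    modes of positive index, which do not see the uniform part of the density. The maximum with 1
    ensures that \<open>C\<close> is positive.\<close>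
  define C where "C = max 1 (max C\<^sub>g C\<^sub>r)"
  \<comment> \<open>The threshold is \<open>1 / M\<close>; it is fixed by \<open>n\<close>,
    \<open>g\<close> and \<open>r0\<close> before \<open>K\<close> and the solution are
    chosen.\<close>
  define M where "M = 16 * (C + 1) + 2 ^ (n + 4) * C"
  have C: "0 < C" by (simp add: C_def)
  have M: "0 < M" unfolding M_def using C by (intro add_pos_pos mult_pos_pos) auto
  have "(\<lambda>t. order_parameter g (\<lambda>\<theta> \<omega>. \<rho> t \<theta> \<omega> - 1 / (2 * pi))) \<in> O[at_top](\<lambda>t. inverse (complex_of_real t ^ n))"
    if K: "0 \<le> K" "K < 1 / M" and sol: "kuramoto_solution n g K \<rho>"
      and \<rho>0: "\<forall>\<theta> \<omega>. \<rho> 0 \<theta> \<omega> = 1 / (2 * pi) + r0 \<theta> \<omega>" for K \<rho>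
  proof -
    have "continuous_on UNIV g"
      using assms(3) unfolding class_C_line_def by (auto dest: spec[of _ 0])
    then interpret kuramoto n g K \<rho>
      using assms(1,2) sol by unfold_locales auto
    have init: "(1 + \<bar>\<tau>\<bar>) ^ n * norm (moment k 0 \<tau>) \<le> C" for k \<tau>
    proof (cases "k = 0")
      case True
      then show ?thesis
        using C\<^sub>g[of \<tau>] by (simp add: moment_def fourier_coeff_0 C_def)
    next
      case False
      have "\<rho> 0 = (\<lambda>\<theta> \<omega>. 1 / (2 * pi) + r0 \<theta> \<omega>)" using \<rho>0 by auto
      then have "fourier_coeff (\<rho> 0) k \<omega> = fourier_coeff r0 k \<omega>" for \<omega>
        using False by (simp add: fourier_coeff_add_const class_C_plane_continuous[OF r0])
      then show ?thesis
        using C\<^sub>r[of \<tau> k] by (simp add: moment_def fourier_coeff_mult C_def mult.assoc)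
    qed
    have "K * M < 1" using K M by (simp add: pos_less_divide_eq)
    then have K_small: "K * (16 * (C + 1) + 2 ^ (n + 4) * C) < 1" unfolding M_def .
    have decay: "norm (R t) * (1 + t) ^ n \<le> 2 * C" if "0 \<le> t" for t
      using assms(1) by (intro R_decay[OF _ K(1) C K_small init that]) simp
    show ?thesis
    proof (rule bigoI[where c = "2 * C"], rule eventually_at_top_linorderI[of 1])
      fix t :: real
      assume t: "1 \<le> t"
      have "norm (R t) * t ^ n \<le> norm (R t) * (1 + t) ^ n"
        using t by (intro mult_left_mono power_mono) auto
      also have "\<dots> \<le> 2 * C" using t by (intro decay) simp
      finally have "norm (R t) \<le> 2 * C * inverse (t ^ n)"
        using t by (simp add: pos_le_divide_eq divide_inverse[symmetric])
      then show "norm (order_parameter g (\<lambda>\<theta> \<omega>. \<rho> t \<theta> \<omega> - 1 / (2 * pi))) \<le>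
          2 * C * norm (inverse (complex_of_real t ^ n))"
        using t by (simp add: order_parameter_eq_R norm_inverse norm_power)
    qed
  qed
  then show ?thesis
    using M by (intro exI[of _ "1 / M"]) auto
qed

end
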